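(* There exists a two-way entanglement purification protocol (2-EPP) for qutrits which produces $1$ good qutrit EPR pair from $4$ qutrit EPR pairs in the presence of up to $1$ error. In particular, 2-EPPs can violate the quantum Singleton bound $n\ge 4t+k$: this inequality fails for $n=4$, $k=1$, $t=1$.
   Context: A qutrit is a quantum system with state space $\mathbb{C}^3$ and orthonormal basis $|0\rangle,|1\rangle,|2\rangle$. A qutrit EPR pair is the state $\frac{1}{\sqrt3}(|00\rangle+|11\rangle+|22\rangle)$ of two qutrits, with the first qutrit held by Alice and the second by Bob. In an entanglement purification protocol on $n$ pairs, Alice prepares $n$ qutrit EPR pairs and sends the second half of each to Bob through a noisy quantum channel, which acts on the $n$ transmitted qutrits. Alice and Bob then process their qutrits by local quantum operations (including measurements) and communication over noiseless classical channels. The protocol is a two-way protocol (2-EPP) if classical communication is allowed in both directions, so that each local operation may depend on all measurement results communicated so far. At the end the parties output pairs of qutrits (one qutrit of each pair with Alice, one with Bob). A 2-EPP produces $k$ good pairs from $n$ pairs with up to $t$ errors if, for every channel of the form $\mathcal{S}\otimes I$, where $\mathcal{S}$ is an arbitrary superoperator (quantum channel) acting on some set of at most $t$ of the $n$ transmitted qutrits (the set being unknown to Alice and Bob) and $I$ is the identity on the remaining transmitted qutrits, the protocol always (with probability 1) outputs at least $k$ pairs that are exactly (fidelity 1) in the state of perfect qutrit EPR pairs. The protocol may not depend on the set of affected qutrits or on $\mathcal{S}$. *)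

theory Defs
  imports "Jordan_Normal_Form.Schur_Decomposition"
begin

section \<open>Operators and superoperators\<close>

definition kron :: "complex mat \<Rightarrow> complex mat \<Rightarrow> complex mat" where
  "kron A B = mat (dim_row A * dim_row B) (dim_col A * dim_col B)
     (\<lambda>(i, j). A $$ (i div dim_row B, j div dim_col B) * B $$ (i mod dim_row B, j mod dim_col B))"

definition mtrace :: "complex mat \<Rightarrow> complex" where
  "mtrace A = (\<Sum>i<dim_row A. A $$ (i, i))"

definition pure_state :: "complex vec \<Rightarrow> complex mat" where
  "pure_state v = mat (dim_vec v) (dim_vec v) (\<lambda>(i, j). v $ i * cnj (v $ j))"

text \<open>Superoperators are given in operator-sum form by finite lists of Kraus operators; \<open>d\<close> is the
  output dimension in \<open>apply_kraus\<close> and the input dimension in \<open>trace_preserving\<close>.\<close>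

definition apply_kraus :: "nat \<Rightarrow> complex mat list \<Rightarrow> complex mat \<Rightarrow> complex mat" where
  "apply_kraus d Ks \<rho> = foldr (+) (map (\<lambda>K. K * \<rho> * mat_adjoint K) Ks) (0\<^sub>m d d)"

definition trace_preserving :: "nat \<Rightarrow> complex mat list \<Rightarrow> bool" where
  "trace_preserving d Ks \<longleftrightarrow> foldr (+) (map (\<lambda>K. mat_adjoint K * K) Ks) (0\<^sub>m d d) = 1\<^sub>m d"

definition quantum_channel :: "nat \<Rightarrow> complex mat list \<Rightarrow> bool" where
  "quantum_channel d Ks \<longleftrightarrow> set Ks \<subseteq> carrier_mat d d \<and> trace_preserving d Ks"


section \<open>Registers of qutrits\<close>

text \<open>The basis state \<open>|x\<rangle>\<close> of \<open>n\<close> qutrits, \<open>x < 3 ^ n\<close>, has qutrit \<open>j\<close> in state \<open>|qutrit j x\<rangle>\<close>.\<close>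

definition qutrit :: "nat \<Rightarrow> nat \<Rightarrow> nat" where
  "qutrit j x = (x div 3 ^ j) mod 3"

text \<open>The index, in the space of the \<open>card T\<close> qutrits at positions \<open>T\<close> (in increasing order),
  of the part of \<open>|x\<rangle>\<close> at these positions.\<close>

definition subindex :: "nat set \<Rightarrow> nat \<Rightarrow> nat" where
  "subindex T x = (\<Sum>j\<in>T. qutrit j x * 3 ^ card {i \<in> T. i < j})"

text \<open>The operator on \<open>n\<close> qutrits which is \<open>K\<close> on the positions \<open>T\<close> and the identity elsewhere.\<close>

definition embed :: "nat \<Rightarrow> nat set \<Rightarrow> complex mat \<Rightarrow> complex mat" where
  "embed n T K = mat (3 ^ n) (3 ^ n) (\<lambda>(x, y).
     if \<forall>j<n. j \<notin> T \<longrightarrow> qutrit j x = qutrit j y then K $$ (subindex T x, subindex T y) else 0)"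

text \<open>A joint state of Alice (dimension \<open>dA\<close>) and Bob (dimension \<open>dB\<close>) is a \<open>dA * dB\<close> square matrix,
  with \<open>|x\<rangle>\<close> of Alice and \<open>|y\<rangle>\<close> of Bob at index \<open>x * dB + y\<close>, in accordance with \<open>kron\<close>.\<close>

definition epr_amplitude :: "nat \<Rightarrow> nat \<Rightarrow> complex" where
  "epr_amplitude a b = (if a = b then 1 / complex_of_real (sqrt 3) else 0)"

definition epr_pairs :: "nat \<Rightarrow> complex vec" where
  "epr_pairs n = vec (3 ^ n * 3 ^ n)
     (\<lambda>i. \<Prod>j<n. epr_amplitude (qutrit j (i div 3 ^ n)) (qutrit j (i mod 3 ^ n)))"

definition noisy_epr_pairs :: "nat \<Rightarrow> nat set \<Rightarrow> complex mat list \<Rightarrow> complex mat" where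
  "noisy_epr_pairs n T Ks =
     apply_kraus (3 ^ n * 3 ^ n) (map (\<lambda>K. kron (1\<^sub>m (3 ^ n)) (embed n T K)) Ks)
       (pure_state (epr_pairs n))"


section \<open>Two-way protocols\<close>

text \<open>A protocol is a tree.  At an \<open>Alice\<close> or \<open>Bob\<close> node that party performs a local quantum operation
  with measurement, whose outcome is announced to the other party; the rest of the protocol
  depends on it.  Each outcome consists of the new dimension of that party's system, the Kraus operators
  of the completely positive map for this outcome, and the rest of the protocol.  Several Kraus
  operators for one outcome allow noise, discarded results and discarded subsystems.
  \<open>Output m\<close> ends the protocol, the systems then being those of \<open>m\<close> pairs of qutrits.\<close>

datatype protocol =
    Output nat
  | Alice "(nat \<times> complex mat list \<times> protocol) list"
  | Bob "(nat \<times> complex mat list \<times> protocol) list"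

definition instrument :: "nat \<Rightarrow> (nat \<times> complex mat list \<times> protocol) list \<Rightarrow> bool" where
  "instrument d bs \<longleftrightarrow>
     (\<forall>(d', Ks, P) \<in> set bs. 0 < d' \<and> set Ks \<subseteq> carrier_mat d' d) \<and>
     trace_preserving d (concat (map (\<lambda>(d', Ks, P). Ks) bs))"

fun wf_protocol :: "nat \<Rightarrow> nat \<Rightarrow> protocol \<Rightarrow> bool" where
  "wf_protocol dA dB (Output m) \<longleftrightarrow> dA = 3 ^ m \<and> dB = 3 ^ m"
| "wf_protocol dA dB (Alice bs) \<longleftrightarrow>
     instrument dA bs \<and> (\<forall>(d, Ks, P) \<in> set bs. wf_protocol d dB P)"
| "wf_protocol dA dB (Bob bs) \<longleftrightarrow>
     instrument dB bs \<and> (\<forall>(d, Ks, P) \<in> set bs. wf_protocol dA d P)"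

definition two_epp :: "nat \<Rightarrow> protocol \<Rightarrow> bool" where
  "two_epp n P \<longleftrightarrow> wf_protocol (3 ^ n) (3 ^ n) P"

text \<open>The possible results of a protocol: the number of output pairs together with their unnormalised
  state, whose trace is the probability of this result.\<close>

fun results :: "nat \<Rightarrow> nat \<Rightarrow> protocol \<Rightarrow> complex mat \<Rightarrow> (nat \<times> complex mat) list" where
  "results dA dB (Output m) \<rho> = [(m, \<rho>)]"
| "results dA dB (Alice bs) \<rho> = concat (map (\<lambda>(d, Ks, P).
     results d dB P (apply_kraus (d * dB) (map (\<lambda>K. kron K (1\<^sub>m dB)) Ks) \<rho>)) bs)"
| "results dA dB (Bob bs) \<rho> = concat (map (\<lambda>(d, Ks, P).
     results dA d P (apply_kraus (dA * d) (map (\<lambda>K. kron (1\<^sub>m dA) K) Ks) \<rho>)) bs)"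

definition produces_good_pairs :: "protocol \<Rightarrow> nat \<Rightarrow> nat \<Rightarrow> nat \<Rightarrow> bool" where
  "produces_good_pairs P k n t \<longleftrightarrow>
     (\<forall>T Ks. T \<subseteq> {..<n} \<and> card T \<le> t \<and> quantum_channel (3 ^ card T) Ks \<longrightarrow>
       (\<forall>(m, \<sigma>) \<in> set (results (3 ^ n) (3 ^ n) P (noisy_epr_pairs n T Ks)).
          mtrace \<sigma> \<noteq> 0 \<longrightarrow>
            k \<le> m \<and> (1 / mtrace \<sigma>) \<cdot>\<^sub>m \<sigma> = pure_state (epr_pairs m)))"

definition quantum_singleton_bound :: "nat \<Rightarrow> nat \<Rightarrow> nat \<Rightarrow> bool" where
  "quantum_singleton_bound n k t \<longleftrightarrow> 4 * t + k \<le> n"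

end

theory Submission
  imports Defs
begin

text \<open>Qutrits 0, 1 and 2 are projected onto a code spanned by three states
  \<open>\<Sum>\<^sub>x \<plusminus>|x, x + l, x + 2 l + i\<rangle> / \<surd>3\<close> with \<open>l < 3\<close> (entries modulo 3), which detects an arbitrary error on one
  qutrit; Alice's result names the code, and Bob measures whether his qutrits lie in the same one.
  If they do, either nothing happened to these three qutrits or the error is invisible to the code, so the
  encoded pair is perfect.  Otherwise the single error hit one of these three qutrits, so the pair
  of qutrits 3 is untouched.  In both cases one perfect pair is left.

  Since the noiseless joint state is maximally entangled, local operators \<open>A\<close> of Alice and \<open>B\<close> of Bob
  turn it, after an error \<open>E\<close> on Bob's side, into the bipartite vector with coefficient matrix \<open>B E A\<^sup>T\<close>.
  Everything thus reduces to showing that this matrix is a multiple of the identity for each run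
  of the protocol.\<close>

section \<open>Kronecker products and adjoints\<close>

lemma mult_mat_entry:
  assumes "A \<in> carrier_mat a b" "B \<in> carrier_mat b c" "i < a" "j < c"
  shows "(A * B) $$ (i, j) = (\<Sum>k<b. A $$ (i, k) * B $$ (k, j))"
  using assms by (simp add: scalar_prod_def lessThan_atLeast0)

lemma mult_mat_vec_entry:
  assumes "A \<in> carrier_mat a b" "v \<in> carrier_vec b" "i < a"
  shows "(A *\<^sub>v v) $ i = (\<Sum>k<b. A $$ (i, k) * v $ k)"
  using assms by (simp add: scalar_prod_def lessThan_atLeast0)

text \<open>\<open>kron\<close> flattens a pair of indices to \<open>i * n + j\<close>. Division
  with remainder inverts this, so a sum over a tensor product splits into independent sums.\<close>

lemma sum_lessThan_mult:
  fixes f :: "nat \<Rightarrow> nat \<Rightarrow> 'a::comm_monoid_add"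
  shows "(\<Sum>k<m * n. f (k div n) (k mod n)) = (\<Sum>i<m. \<Sum>j<n. f i j)"
proof (cases "n = 0")
  case False
  have "(\<Sum>i<m. \<Sum>j<n. f i j) = (\<Sum>(i, j)\<in>{..<m} \<times> {..<n}. f i j)"
    by (simp add: sum.cartesian_product)
  also have "\<dots> = (\<Sum>k<m * n. f (k div n) (k mod n))"
  proof (rule sum.reindex_bij_witness[where i = "\<lambda>k. (k div n, k mod n)" and j = "\<lambda>(i, j). i * n + j"])
    fix p assume "p \<in> {..<m} \<times> {..<n}"
    then obtain i j where p: "p = (i, j)" "i < m" "j < n" by auto
    have "i * n + j < Suc i * n" using p by simp
    also have "\<dots> \<le> m * n" using p by (intro mult_le_mono1) simp
    finally show "(case p of (i, j) \<Rightarrow> i * n + j) \<in> {..<m * n}" using p by simp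
  qed (use False in \<open>auto simp: less_mult_imp_div_less split: prod.splits\<close>)
  finally show ?thesis by simp
qed simp

lemma kron_carrier [simp]:
  "A \<in> carrier_mat a b \<Longrightarrow> B \<in> carrier_mat c d \<Longrightarrow> kron A B \<in> carrier_mat (a * c) (b * d)"
  by (auto simp: kron_def)

lemma kron_entry:
  assumes "A \<in> carrier_mat a b" "B \<in> carrier_mat c d" "i < a * c" "j < b * d"
  shows "kron A B $$ (i, j) = A $$ (i div c, j div d) * B $$ (i mod c, j mod d)"
  using assms by (auto simp: kron_def)

text \<open>The intermediate index is a pair, and the sum over it factors into two sums. This
  mixed-product rule carries all later calculations with local operators.\<close>

lemma kron_mult:
  assumes A: "A \<in> carrier_mat a b" and B: "B \<in> carrier_mat c d"
    and A': "A' \<in> carrier_mat b e" and B': "B' \<in> carrier_mat d f"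
  shows "kron A B * kron A' B' = kron (A * A') (B * B')" (is "?l = ?r")
proof (rule eq_matI)
  have AA: "A * A' \<in> carrier_mat a e" and BB: "B * B' \<in> carrier_mat c f"
    using assms by auto
  show "dim_row ?l = dim_row ?r" "dim_col ?l = dim_col ?r"
    using assms by (auto simp: kron_def)
  fix i j assume "i < dim_row ?r" "j < dim_col ?r"
  then have i: "i < a * c" and j: "j < e * f" using assms by (auto simp: kron_def)
  then have pos: "0 < c" "0 < f" by (auto intro: gr0I)
  have d: "i div c < a" "j div f < e" "i mod c < c" "j mod f < f"
    using i j pos by (simp_all add: less_mult_imp_div_less)
  have "?l $$ (i, j) = (\<Sum>k<b * d. kron A B $$ (i, k) * kron A' B' $$ (k, j))"
    using i j by (intro mult_mat_entry[OF kron_carrier[OF A B] kron_carrier[OF A' B']])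
  also have "\<dots> = (\<Sum>k<b * d. A $$ (i div c, k div d) * B $$ (i mod c, k mod d)
      * (A' $$ (k div d, j div f) * B' $$ (k mod d, j mod f)))"
    using i j by (intro sum.cong) (simp_all add: kron_entry[OF A B] kron_entry[OF A' B'])
  also have "\<dots> = (\<Sum>k<b. \<Sum>l<d. A $$ (i div c, k) * B $$ (i mod c, l)
      * (A' $$ (k, j div f) * B' $$ (l, j mod f)))"
    by (rule sum_lessThan_mult)
  also have "\<dots> = (A * A') $$ (i div c, j div f) * (B * B') $$ (i mod c, j mod f)"
    using d by (simp add: mult_mat_entry[OF A A'] mult_mat_entry[OF B B'] sum_product mult.assoc
        mult.left_commute)
  also have "\<dots> = ?r $$ (i, j)" using i j by (simp add: kron_entry[OF AA BB])
  finally show "?l $$ (i, j) = ?r $$ (i, j)" .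
qed

lemma div_mod_eq_iff: "(i :: nat) div c = j div c \<and> i mod c = j mod c \<longleftrightarrow> i = j"
  by (metis div_mod_decomp)

lemma kron_one: "kron (1\<^sub>m a) (1\<^sub>m b) = 1\<^sub>m (a * b)"
proof (rule eq_matI)
  fix i j assume "i < dim_row (1\<^sub>m (a * b))" "j < dim_col (1\<^sub>m (a * b))"
  then have ij: "i < a * b" "j < a * b" by auto
  then have "0 < b" by (auto intro: gr0I)
  with ij show "kron (1\<^sub>m a) (1\<^sub>m b) $$ (i, j) = 1\<^sub>m (a * b) $$ (i, j)"
    using div_mod_eq_iff[of i b j]
    by (auto simp: kron_entry[OF one_carrier_mat one_carrier_mat] less_mult_imp_div_less)
qed (auto simp: kron_def)

lemma kron_add_right:
  assumes A: "A \<in> carrier_mat a b" and B: "B \<in> carrier_mat c d" and B': "B' \<in> carrier_mat c d"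
  shows "kron A (B + B') = kron A B + kron A B'"
proof (rule eq_matI)
  have BB: "B + B' \<in> carrier_mat c d" using B B' by simp
  fix i j assume "i < dim_row (kron A B + kron A B')" "j < dim_col (kron A B + kron A B')"
  then have ij: "i < a * c" "j < b * d" using assms by (auto simp: kron_def)
  then have "0 < c" "0 < d" by (auto intro: gr0I)
  with ij show "kron A (B + B') $$ (i, j) = (kron A B + kron A B') $$ (i, j)"
    using assms carrier_matD[OF kron_carrier[OF A B']]
    by (simp add: kron_entry[OF A BB] kron_entry[OF A B] kron_entry[OF A B'] distrib_left)
qed (use assms in \<open>auto simp: kron_def\<close>)

lemma kron_add_left:
  assumes A: "A \<in> carrier_mat a b" and A': "A' \<in> carrier_mat a b" and B: "B \<in> carrier_mat c d"
  shows "kron (A + A') B = kron A B + kron A' B"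
proof (rule eq_matI)
  have AA: "A + A' \<in> carrier_mat a b" using A A' by simp
  fix i j assume "i < dim_row (kron A B + kron A' B)" "j < dim_col (kron A B + kron A' B)"
  then have ij: "i < a * c" "j < b * d" using assms by (auto simp: kron_def)
  then show "kron (A + A') B $$ (i, j) = (kron A B + kron A' B) $$ (i, j)"
    using assms carrier_matD[OF kron_carrier[OF A' B]]
    by (simp add: kron_entry[OF AA B] kron_entry[OF A B] kron_entry[OF A' B] distrib_right
        less_mult_imp_div_less)
qed (use assms in \<open>auto simp: kron_def\<close>)

lemma kron_zero_left:
  assumes "B \<in> carrier_mat c d" shows "kron (0\<^sub>m a b) B = 0\<^sub>m (a * c) (b * d)"
proof (rule eq_matI)
  fix i j assume "i < dim_row (0\<^sub>m (a * c) (b * d))" "j < dim_col (0\<^sub>m (a * c) (b * d))"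
  then have ij: "i < a * c" "j < b * d" by auto
  then show "kron (0\<^sub>m a b) B $$ (i, j) = 0\<^sub>m (a * c) (b * d) $$ (i, j)"
    using kron_entry[OF zero_carrier_mat assms ij] by (simp add: less_mult_imp_div_less)
qed (use assms in \<open>auto simp: kron_def\<close>)

lemma kron_zero_right:
  assumes "A \<in> carrier_mat a b" shows "kron A (0\<^sub>m c d) = 0\<^sub>m (a * c) (b * d)"
proof (rule eq_matI)
  fix i j assume "i < dim_row (0\<^sub>m (a * c) (b * d))" "j < dim_col (0\<^sub>m (a * c) (b * d))"
  then have ij: "i < a * c" "j < b * d" by auto
  then have "0 < c" "0 < d" by (auto intro: gr0I)
  with ij show "kron A (0\<^sub>m c d) $$ (i, j) = 0\<^sub>m (a * c) (b * d) $$ (i, j)"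
    using kron_entry[OF assms zero_carrier_mat ij] by simp
qed (use assms in \<open>auto simp: kron_def\<close>)

lemma kron_transpose: "transpose_mat (kron A B) = kron (transpose_mat A) (transpose_mat B)"
proof (rule eq_matI)
  fix i j
  assume "i < dim_row (kron (transpose_mat A) (transpose_mat B))"
    "j < dim_col (kron (transpose_mat A) (transpose_mat B))"
  then have ij: "i < dim_col A * dim_col B" "j < dim_row A * dim_row B" by (auto simp: kron_def)
  then have "0 < dim_col B" "0 < dim_row B" by (auto intro: gr0I)
  with ij show "transpose_mat (kron A B) $$ (i, j) = kron (transpose_mat A) (transpose_mat B) $$ (i, j)"
    by (simp add: kron_def less_mult_imp_div_less)
qed (auto simp: kron_def)

text \<open>A register that has been measured out leaves a factor of size 1 by 1, that is, only an
  amplitude in front of the other factor.\<close>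

lemma kron_scalar_left:
  assumes "A \<in> carrier_mat 1 1" shows "kron A B = A $$ (0, 0) \<cdot>\<^sub>m B"
  using assms by (intro eq_matI) (auto simp: kron_def)

lemma kron_scalar_right:
  assumes "B \<in> carrier_mat 1 1" shows "kron A B = B $$ (0, 0) \<cdot>\<^sub>m A"
  using assms by (intro eq_matI) (auto simp: kron_def)

section \<open>Adjoints, and Kraus operators acting on pure states\<close>

lemma mat_adjoint_entry [simp]:
  fixes A :: "complex mat"
  shows "i < dim_col A \<Longrightarrow> j < dim_row A \<Longrightarrow> mat_adjoint A $$ (i, j) = cnj (A $$ (j, i))"
  by (simp add: mat_adjoint_def mat_of_rows_def)

lemma mat_adjoint_dim [simp]:
  fixes A :: "complex mat"
  shows "dim_row (mat_adjoint A) = dim_col A" "dim_col (mat_adjoint A) = dim_row A"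
  by (simp_all add: mat_adjoint_def)

lemma mat_adjoint_carrier [simp]:
  fixes A :: "complex mat"
  shows "A \<in> carrier_mat a b \<Longrightarrow> mat_adjoint A \<in> carrier_mat b a"
  by (intro carrier_matI) (simp_all add: carrier_matD)

text \<open>With the adjoint split into transposition and conjugation, its rule for Kronecker
  products reduces to two entrywise checks.\<close>

lemma mat_adjoint_eq: "mat_adjoint A = map_mat cnj (transpose_mat A)"
  for A :: "complex mat"
  by (rule eq_matI) auto

lemma map_mat_cnj_kron: "map_mat cnj (kron A B) = kron (map_mat cnj A) (map_mat cnj B)"
proof (rule eq_matI)
  fix i j
  assume "i < dim_row (kron (map_mat cnj A) (map_mat cnj B))"
    "j < dim_col (kron (map_mat cnj A) (map_mat cnj B))"
  then have ij: "i < dim_row A * dim_row B" "j < dim_col A * dim_col B" by (auto simp: kron_def)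
  then have "0 < dim_row B" "0 < dim_col B" by (auto intro: gr0I)
  with ij show "map_mat cnj (kron A B) $$ (i, j) = kron (map_mat cnj A) (map_mat cnj B) $$ (i, j)"
    by (simp add: kron_def less_mult_imp_div_less)
qed (auto simp: kron_def)

lemma mat_adjoint_kron: "mat_adjoint (kron A B) = kron (mat_adjoint A) (mat_adjoint B)"
  by (simp only: mat_adjoint_eq kron_transpose map_mat_cnj_kron)

lemma mat_adjoint_mult:
  fixes A B :: "complex mat"
  assumes A: "A \<in> carrier_mat a b" and B: "B \<in> carrier_mat b c"
  shows "mat_adjoint (A * B) = mat_adjoint B * mat_adjoint A"
proof (rule eq_matI)
  fix i j
  assume "i < dim_row (mat_adjoint B * mat_adjoint A)" "j < dim_col (mat_adjoint B * mat_adjoint A)"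
  then have ij: "i < c" "j < a" using assms by auto
  have "mat_adjoint (A * B) $$ (i, j) = cnj (\<Sum>k<b. A $$ (j, k) * B $$ (k, i))"
    using assms ij by (simp only: mat_adjoint_entry index_mult_mat(2,3) carrier_matD mult_mat_entry[OF A B])
  also have "\<dots> = (\<Sum>k<b. mat_adjoint B $$ (i, k) * mat_adjoint A $$ (k, j))"
    using A B ij by (simp add: mult.commute)
  also have "\<dots> = (mat_adjoint B * mat_adjoint A) $$ (i, j)"
    by (rule mult_mat_entry[symmetric, OF mat_adjoint_carrier[OF B] mat_adjoint_carrier[OF A] ij])
  finally show "mat_adjoint (A * B) $$ (i, j) = (mat_adjoint B * mat_adjoint A) $$ (i, j)" .
qed (use assms in auto)

lemma kraus_operator_pure_state:
  fixes K :: "complex mat"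
  assumes K: "K \<in> carrier_mat d' d" and v: "v \<in> carrier_vec d"
  shows "K * pure_state v * mat_adjoint K = pure_state (K *\<^sub>v v)"
proof (rule eq_matI)
  have P: "pure_state v \<in> carrier_mat d d" using v by (auto simp: pure_state_def)
  have KP: "K * pure_state v \<in> carrier_mat d' d" using K P by simp
  fix i j assume "i < dim_row (pure_state (K *\<^sub>v v))" "j < dim_col (pure_state (K *\<^sub>v v))"
  then have ij: "i < d'" "j < d'" using K by (auto simp: pure_state_def)
  have "(K * pure_state v) $$ (i, l) = (\<Sum>k<d. K $$ (i, k) * v $ k) * cnj (v $ l)" if "l < d" for l
    using v mult_mat_entry[OF K P ij(1) that] that
    by (simp add: pure_state_def sum_distrib_right mult.assoc)
  then have "(K * pure_state v * mat_adjoint K) $$ (i, j)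
    = (\<Sum>k<d. K $$ (i, k) * v $ k) * (\<Sum>l<d. cnj (v $ l) * cnj (K $$ (j, l)))"
    using K ij mult_mat_entry[OF KP mat_adjoint_carrier[OF K] ij]
    by (simp add: sum_distrib_left mult.assoc del: index_mult_mat)
  also have "\<dots> = (K *\<^sub>v v) $ i * cnj ((K *\<^sub>v v) $ j)"
    by (simp add: mult_mat_vec_entry[OF K v] ij mult.commute del: index_mult_mat_vec)
  finally show "(K * pure_state v * mat_adjoint K) $$ (i, j) = pure_state (K *\<^sub>v v) $$ (i, j)"
    using K ij by (simp add: pure_state_def)
qed (use K in \<open>auto simp: pure_state_def\<close>)

lemma mat_adjoint_minus:
  fixes A B :: "complex mat"
  assumes "A \<in> carrier_mat a b" "B \<in> carrier_mat a b"
  shows "mat_adjoint (A - B) = mat_adjoint A - mat_adjoint B"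
  using assms by (intro eq_matI) auto

lemma mat_adjoint_one: "mat_adjoint (1\<^sub>m n :: complex mat) = 1\<^sub>m n"
  by (intro eq_matI) auto

lemma mat_adjoint_mat_adjoint: "mat_adjoint (mat_adjoint A) = A" for A :: "complex mat"
  by (intro eq_matI) auto

lemma transpose_mat_smult: "transpose_mat (c \<cdot>\<^sub>m A) = c \<cdot>\<^sub>m transpose_mat A"
  by (intro eq_matI) auto

section \<open>Mixtures of pure states\<close>

text \<open>No weights occur because the vectors are unnormalised: a weight is absorbed into the
  length of its vector.\<close>

definition mixtures :: "nat \<Rightarrow> complex vec set \<Rightarrow> complex mat set" where
  "mixtures d S = {foldr (+) (map pure_state vs) (0\<^sub>m d d) | vs. set vs \<subseteq> S}"

lemma pure_state_carrier [simp]: "v \<in> carrier_vec d \<Longrightarrow> pure_state v \<in> carrier_mat d d"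
  by (auto simp: pure_state_def)

lemma foldr_add_carrier:
  "set Ms \<subseteq> carrier_mat a b \<Longrightarrow> foldr (+) Ms (0\<^sub>m a b) \<in> carrier_mat a b"
  by (induction Ms) auto

lemma foldr_add_append:
  fixes Ms Ns :: "'a::monoid_add mat list"
  assumes "set Ms \<subseteq> carrier_mat a b" "set Ns \<subseteq> carrier_mat a b"
  shows "foldr (+) (Ms @ Ns) (0\<^sub>m a b) = foldr (+) Ms (0\<^sub>m a b) + foldr (+) Ns (0\<^sub>m a b)"
  using assms
proof (induction Ms)
  case Nil
  then show ?case using foldr_add_carrier[of Ns a b] by (simp add: left_add_zero_mat[of "foldr (+) Ns (0\<^sub>m a b)" a b])
next
  case (Cons M Ms)
  then show ?case using foldr_add_carrier[of Ns a b] foldr_add_carrier[of Ms a b]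
    by (simp add: assoc_add_mat[of _ a b])
qed

lemma pure_state_in_mixtures: "v \<in> S \<Longrightarrow> v \<in> carrier_vec d \<Longrightarrow> pure_state v \<in> mixtures d S"
  unfolding mixtures_def by (intro CollectI exI[of _ "[v]"]) simp

lemma mixtures_mono: "S \<subseteq> S' \<Longrightarrow> mixtures d S \<subseteq> mixtures d S'"
  unfolding mixtures_def by blast

lemma mixtures_add:
  assumes "S \<subseteq> carrier_vec d" "\<rho> \<in> mixtures d S" "\<sigma> \<in> mixtures d S"
  shows "\<rho> + \<sigma> \<in> mixtures d S"
proof -
  obtain vs ws where vw: "set vs \<subseteq> S" "set ws \<subseteq> S"
    "\<rho> = foldr (+) (map pure_state vs) (0\<^sub>m d d)" "\<sigma> = foldr (+) (map pure_state ws) (0\<^sub>m d d)"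
    using assms by (auto simp: mixtures_def)
  then have "\<rho> + \<sigma> = foldr (+) (map pure_state (vs @ ws)) (0\<^sub>m d d)"
    unfolding map_append using assms(1)
    by (subst foldr_add_append) auto
  then show ?thesis using vw unfolding mixtures_def
    by (metis (mono_tags, lifting) mem_Collect_eq set_append Un_least)
qed

lemma kraus_operator_mixture:
  assumes K: "K \<in> carrier_mat d' d" and S: "S \<subseteq> carrier_vec d" and vs: "set vs \<subseteq> S"
  shows "K * foldr (+) (map pure_state vs) (0\<^sub>m d d) * mat_adjoint K
    = foldr (+) (map pure_state (map ((*\<^sub>v) K) vs)) (0\<^sub>m d' d')"
  using vs
proof (induction vs)
  case Nil
  then show ?case using K by simp
next
  case (Cons v vs)
  let ?\<rho> = "foldr (+) (map pure_state vs) (0\<^sub>m d d)"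
  have v: "v \<in> carrier_vec d" and vs: "set vs \<subseteq> S" using Cons S by auto
  have \<rho>: "?\<rho> \<in> carrier_mat d d"
    using vs S by (intro foldr_add_carrier) auto
  have P: "pure_state v \<in> carrier_mat d d" using v by simp
  have "K * (pure_state v + ?\<rho>) * mat_adjoint K
    = K * pure_state v * mat_adjoint K + K * ?\<rho> * mat_adjoint K"
    using K \<rho> P by (simp add: mult_add_distrib_mat[OF K] add_mult_distrib_mat[of _ d' d _ _ d'])
  also have "\<dots> = pure_state (K *\<^sub>v v) + K * ?\<rho> * mat_adjoint K"
    using kraus_operator_pure_state[OF K v] by simp
  finally show ?case using Cons.IH[OF vs] by simp
qed

text \<open>Each Kraus operator maps a mixture of vectors to the mixture of their images, and the
  sum over the operators only joins these lists. A superoperator can therefore be followed on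
  vectors alone.\<close>

lemma apply_kraus_mixture:
  assumes \<rho>: "\<rho> \<in> mixtures d S" and S: "S \<subseteq> carrier_vec d" and Ks: "set Ks \<subseteq> carrier_mat d' d"
    and S': "S' \<subseteq> carrier_vec d'" and step: "\<And>K v. K \<in> set Ks \<Longrightarrow> v \<in> S \<Longrightarrow> K *\<^sub>v v \<in> S'"
  shows "apply_kraus d' Ks \<rho> \<in> mixtures d' S'"
  using Ks step
proof (induction Ks)
  case Nil
  show ?case unfolding mixtures_def apply_kraus_def by (intro CollectI exI[of _ "[]"]) simp
next
  case (Cons K Ks)
  obtain vs where vs: "set vs \<subseteq> S" "\<rho> = foldr (+) (map pure_state vs) (0\<^sub>m d d)"
    using \<rho> by (auto simp: mixtures_def)
  have "K * \<rho> * mat_adjoint K = foldr (+) (map pure_state (map ((*\<^sub>v) K) vs)) (0\<^sub>m d' d')"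
    unfolding vs(2) using Cons.prems vs S by (intro kraus_operator_mixture) auto
  moreover have "set (map ((*\<^sub>v) K) vs) \<subseteq> S'" using Cons.prems vs by auto
  ultimately have "K * \<rho> * mat_adjoint K \<in> mixtures d' S'" unfolding mixtures_def by blast
  moreover have "apply_kraus d' Ks \<rho> \<in> mixtures d' S'" using Cons by auto
  ultimately show ?case
    using mixtures_add[OF S'] by (simp add: apply_kraus_def)
qed

lemma pure_state_smult: "pure_state (c \<cdot>\<^sub>v v) = (c * cnj c) \<cdot>\<^sub>m pure_state v"
  by (intro eq_matI) (auto simp: pure_state_def)

text \<open>Multiples \<open>c\<close> of a single vector contribute multiples
  \<open>c * cnj c\<close> of a single projector, and these add up.\<close>

lemma mixtures_of_one_state:
  assumes "\<rho> \<in> mixtures d {c \<cdot>\<^sub>v v | c. True}" "v \<in> carrier_vec d"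
  shows "\<exists>r. \<rho> = r \<cdot>\<^sub>m pure_state v"
proof -
  obtain vs where vs: "set vs \<subseteq> {c \<cdot>\<^sub>v v | c. True}" "\<rho> = foldr (+) (map pure_state vs) (0\<^sub>m d d)"
    using assms by (auto simp: mixtures_def)
  have "\<exists>r. foldr (+) (map pure_state vs) (0\<^sub>m d d) = r \<cdot>\<^sub>m pure_state v"
    using vs(1)
  proof (induction vs)
    case Nil
    then show ?case using assms(2) by (intro exI[of _ 0] eq_matI) (auto simp: pure_state_def)
  next
    case (Cons w vs)
    then obtain r c where "foldr (+) (map pure_state vs) (0\<^sub>m d d) = r \<cdot>\<^sub>m pure_state v"
      "w = c \<cdot>\<^sub>v v" by auto
    then show ?case
      by (intro exI[of _ "c * cnj c + r"]) (simp add: pure_state_smult add_smult_distrib_right_mat[OF pure_state_carrier[OF assms(2)]])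
  qed
  then show ?thesis using vs by simp
qed

section \<open>Bipartite vectors as matrices\<close>

text \<open>Bob's index is the row, so that his operators act from the left and errors need no transposition.\<close>

definition bipartite :: "complex mat \<Rightarrow> complex vec" where
  "bipartite N = vec (dim_col N * dim_row N) (\<lambda>i. N $$ (i mod dim_row N, i div dim_row N))"

lemma bipartite_carrier [simp]: "N \<in> carrier_mat b a \<Longrightarrow> bipartite N \<in> carrier_vec (a * b)"
  by (auto simp: bipartite_def)

text \<open>This is the vectorisation identity. Local operators become left and right
  multiplications of the coefficient matrix; Alice's is transposed, without conjugation, because her
  index is the column.\<close>

lemma kron_mult_bipartite:
  assumes A: "A \<in> carrier_mat a' a" and B: "B \<in> carrier_mat b' b" and N: "N \<in> carrier_mat b a"
  shows "kron A B *\<^sub>v bipartite N = bipartite (B * N * transpose_mat A)"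
proof (rule eq_vecI)
  have BN: "B * N \<in> carrier_mat b' a" and A': "transpose_mat A \<in> carrier_mat a a'"
    using assms by auto
  show "dim_vec (kron A B *\<^sub>v bipartite N) = dim_vec (bipartite (B * N * transpose_mat A))"
    using assms by (auto simp: bipartite_def kron_def)
  fix i assume "i < dim_vec (bipartite (B * N * transpose_mat A))"
  then have i: "i < a' * b'" using assms by (auto simp: bipartite_def)
  then have pos: "0 < b'" by (auto intro: gr0I)
  then have d: "i div b' < a'" "i mod b' < b'" using i by (simp_all add: less_mult_imp_div_less)
  have "(kron A B *\<^sub>v bipartite N) $ i = (\<Sum>k<a * b. kron A B $$ (i, k) * bipartite N $ k)"
    by (rule mult_mat_vec_entry[OF kron_carrier[OF A B] bipartite_carrier[OF N] i])
  also have "\<dots> = (\<Sum>k<a * b. A $$ (i div b', k div b) * B $$ (i mod b', k mod b) * N $$ (k mod b, k div b))"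
    using i N by (intro sum.cong) (simp_all add: kron_entry[OF A B] bipartite_def)
  also have "\<dots> = (\<Sum>x<a. \<Sum>y<b. A $$ (i div b', x) * B $$ (i mod b', y) * N $$ (y, x))"
    by (rule sum_lessThan_mult)
  also have "\<dots> = (\<Sum>x<a. (B * N) $$ (i mod b', x) * transpose_mat A $$ (x, i div b'))"
  proof (rule sum.cong[OF refl])
    fix x assume "x \<in> {..<a}"
    then have x: "x < a" by simp
    show "(\<Sum>y<b. A $$ (i div b', x) * B $$ (i mod b', y) * N $$ (y, x))
      = (B * N) $$ (i mod b', x) * transpose_mat A $$ (x, i div b')"
      using A d x mult_mat_entry[OF B N d(2) x]
      by (simp add: sum_distrib_left sum_distrib_right mult_ac del: index_mult_mat(1))
  qed
  also have "\<dots> = (B * N * transpose_mat A) $$ (i mod b', i div b')"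
    by (rule mult_mat_entry[OF BN A' d(2,1), symmetric])
  also have "\<dots> = bipartite (B * N * transpose_mat A) $ i"
    using assms i by (simp add: bipartite_def)
  finally show "(kron A B *\<^sub>v bipartite N) $ i = bipartite (B * N * transpose_mat A) $ i" .
qed

lemma bipartite_smult: "bipartite (c \<cdot>\<^sub>m N) = c \<cdot>\<^sub>v bipartite N"
proof (rule eq_vecI)
  fix i assume "i < dim_vec (c \<cdot>\<^sub>v bipartite N)"
  then have i: "i < dim_col N * dim_row N" by (simp add: bipartite_def)
  then have "0 < dim_row N" by (auto intro: gr0I)
  with i show "bipartite (c \<cdot>\<^sub>m N) $ i = (c \<cdot>\<^sub>v bipartite N) $ i"
    by (simp add: bipartite_def less_mult_imp_div_less)
qed (simp add: bipartite_def)

section \<open>EPR pairs as multiples of the identity matrix\<close>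

lemma eq_iff_qutrits_eq:
  "x < 3 ^ n \<Longrightarrow> y < 3 ^ n \<Longrightarrow> (\<forall>j<n. qutrit j x = qutrit j y) \<longleftrightarrow> x = y"
proof (induction n arbitrary: x y)
  case (Suc n)
  \<comment> \<open>The induction peels off the lowest ternary digit, so the remaining digits are
    those of the quotient by 3.\<close>
  have shift: "qutrit (Suc j) z = qutrit j (z div 3)" for j z
    by (simp add: qutrit_def div_mult2_eq)
  have less: "x div 3 < 3 ^ n" "y div 3 < 3 ^ n" using Suc.prems by auto
  have "(\<forall>j<Suc n. qutrit j x = qutrit j y) \<longleftrightarrow>
      x mod 3 = y mod 3 \<and> (\<forall>j<n. qutrit j (x div 3) = qutrit j (y div 3))"
    by (auto simp: shift All_less_Suc2) (auto simp: qutrit_def)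
  also have "\<dots> \<longleftrightarrow> x = y"
    unfolding Suc.IH[OF less] using div_mod_eq_iff[of x 3 y] by blast
  finally show ?case .
qed simp

text \<open>The product of amplitudes vanishes unless all digits agree, that is, unless the indices
  of Alice and Bob coincide.\<close>

lemma epr_pairs_eq_bipartite:
  "epr_pairs n = bipartite ((1 / complex_of_real (sqrt 3)) ^ n \<cdot>\<^sub>m 1\<^sub>m (3 ^ n))"
proof (rule eq_vecI)
  fix i
  assume "i < dim_vec (bipartite ((1 / complex_of_real (sqrt 3)) ^ n \<cdot>\<^sub>m 1\<^sub>m (3 ^ n)))"
  then have i: "i < 3 ^ n * 3 ^ n" by (simp add: bipartite_def)
  then have d: "i div 3 ^ n < 3 ^ n" "i mod 3 ^ n < 3 ^ n" by (simp_all add: less_mult_imp_div_less)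
  have "(\<Prod>j<n. epr_amplitude (qutrit j (i div 3 ^ n)) (qutrit j (i mod 3 ^ n)))
    = (if i div 3 ^ n = i mod 3 ^ n then (1 / complex_of_real (sqrt 3)) ^ n else 0)"
    using eq_iff_qutrits_eq[OF d] by (auto simp: epr_amplitude_def)
  then show "epr_pairs n $ i = bipartite ((1 / complex_of_real (sqrt 3)) ^ n \<cdot>\<^sub>m 1\<^sub>m (3 ^ n)) $ i"
    using i d by (auto simp: epr_pairs_def bipartite_def)
qed (simp add: epr_pairs_def bipartite_def)

text \<open>Three diagonal entries equal to 1/3 remain. This fixes the scalar once a result is known
  to be proportional to the EPR projector.\<close>

lemma mtrace_epr_pair: "mtrace (pure_state (epr_pairs 1)) = 1"
proof -
  have "mtrace (pure_state (epr_pairs 1)) = (\<Sum>i<3 * 3. epr_pairs 1 $ i * cnj (epr_pairs 1 $ i))"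
    by (simp add: mtrace_def pure_state_def epr_pairs_def)
  also have "\<dots> = (\<Sum>i<(3 * 3 :: nat). if i div 3 = i mod 3 then 1 / 3 else 0)"
  proof (rule sum.cong[OF refl])
    fix i :: nat assume "i \<in> {..<3 * 3}"
    then have "i < 9" by simp
    then have "qutrit 0 (i div 3) = i div 3" "qutrit 0 (i mod 3) = i mod 3"
      by (simp_all add: qutrit_def)
    with \<open>i < 9\<close> show "epr_pairs 1 $ i * cnj (epr_pairs 1 $ i)
        = (if i div 3 = i mod 3 then 1 / 3 else 0)"
      by (simp add: epr_pairs_def epr_amplitude_def flip: of_real_mult)
  qed
  also have "\<dots> = (\<Sum>a<(3::nat). \<Sum>b<(3::nat). if a = b then 1 / 3 else 0)"
    by (rule sum_lessThan_mult)
  also have "\<dots> = 1"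
    by simp
  finally show ?thesis .
qed

section \<open>Gram sums of Kraus operators\<close>

text \<open>Separated from \<open>trace_preserving\<close> so that the contribution of each outcome
  of an instrument can be computed alone and added afterwards.\<close>

definition gram :: "nat \<Rightarrow> complex mat list \<Rightarrow> complex mat" where
  "gram d Ks = foldr (+) (map (\<lambda>K. mat_adjoint K * K) Ks) (0\<^sub>m d d)"

lemma trace_preserving_iff_gram: "trace_preserving d Ks \<longleftrightarrow> gram d Ks = 1\<^sub>m d"
  by (simp add: trace_preserving_def gram_def)

lemma gram_carrier:
  assumes "\<forall>K\<in>set Ks. dim_col K = d" shows "gram d Ks \<in> carrier_mat d d"
  unfolding gram_def using assms by (intro foldr_add_carrier) (auto intro!: carrier_matI)

lemma gram_entry:
  assumes "\<forall>K\<in>set Ks. dim_col K = d" "i < d" "j < d"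
  shows "gram d Ks $$ (i, j) = (\<Sum>K\<leftarrow>Ks. \<Sum>k<dim_row K. cnj (K $$ (k, i)) * K $$ (k, j))"
  using assms
proof (induction Ks)
  case (Cons K Ks)
  have K: "K \<in> carrier_mat (dim_row K) d" using Cons.prems by auto
  have G: "gram d Ks \<in> carrier_mat d d" using Cons.prems by (intro gram_carrier) auto
  have "gram d (K # Ks) $$ (i, j) = (mat_adjoint K * K) $$ (i, j) + gram d Ks $$ (i, j)"
    using Cons.prems G by (simp add: gram_def del: index_mult_mat(1))
  moreover have "(mat_adjoint K * K) $$ (i, j) = (\<Sum>k<dim_row K. cnj (K $$ (k, i)) * K $$ (k, j))"
    using mult_mat_entry[OF mat_adjoint_carrier[OF K] K Cons.prems(2,3)] Cons.prems by simp
  ultimately show ?case using Cons by simp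
qed (simp add: gram_def)

lemma gram_append:
  assumes "\<forall>K\<in>set Ks \<union> set Ls. dim_col K = d"
  shows "gram d (Ks @ Ls) = gram d Ks + gram d Ls"
  unfolding gram_def map_append using assms
  by (intro foldr_add_append) (auto intro!: carrier_matI)

text \<open>An additive \<open>G\<close> commutes with the sum over Kraus operators. Tensoring with
  a fixed operator from either side is an instance.\<close>

lemma gram_map:
  assumes zero: "G (0\<^sub>m d d) = 0\<^sub>m d' d'"
    and add: "\<And>X Y. X \<in> carrier_mat d d \<Longrightarrow> Y \<in> carrier_mat d d \<Longrightarrow> G (X + Y) = G X + G Y"
    and F: "\<And>K. dim_col K = d \<Longrightarrow> mat_adjoint (F K) * F K = G (mat_adjoint K * K)"
    and Ks: "\<forall>K\<in>set Ks. dim_col K = d"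
  shows "gram d' (map F Ks) = G (gram d Ks)"
  using Ks
proof (induction Ks)
  case Nil
  show ?case by (simp add: gram_def zero)
next
  case (Cons K Ks)
  have "gram d Ks \<in> carrier_mat d d" using Cons.prems by (intro gram_carrier) auto
  moreover have "mat_adjoint K * K \<in> carrier_mat d d" using Cons.prems by (intro carrier_matI) auto
  ultimately show ?case using Cons by (simp add: gram_def add F)
qed

lemma gram_kron_right:
  assumes A: "A \<in> carrier_mat a' a" and Ks: "\<forall>K\<in>set Ks. dim_col K = d"
  shows "gram (a * d) (map (kron A) Ks) = kron (mat_adjoint A * A) (gram d Ks)"
proof (rule gram_map[OF _ _ _ Ks])
  note AA = mult_carrier_mat[OF mat_adjoint_carrier[OF A] A]
  show "kron (mat_adjoint A * A) (0\<^sub>m d d) = 0\<^sub>m (a * d) (a * d)" by (rule kron_zero_right[OF AA])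
  show "kron (mat_adjoint A * A) (X + Y) = kron (mat_adjoint A * A) X + kron (mat_adjoint A * A) Y"
    if "X \<in> carrier_mat d d" "Y \<in> carrier_mat d d" for X Y
    by (rule kron_add_right[OF AA that])
  show "mat_adjoint (kron A K) * kron A K = kron (mat_adjoint A * A) (mat_adjoint K * K)"
    if "dim_col K = d" for K
    unfolding mat_adjoint_kron
    by (rule kron_mult[OF mat_adjoint_carrier[OF A] mat_adjoint_carrier A]) (rule carrier_matI[OF refl that])+
qed

lemma gram_kron_left:
  assumes B: "B \<in> carrier_mat b' b" and Ks: "\<forall>K\<in>set Ks. dim_col K = d"
  shows "gram (d * b) (map (\<lambda>K. kron K B) Ks) = kron (gram d Ks) (mat_adjoint B * B)"
proof (rule gram_map[OF _ _ _ Ks, where G = "\<lambda>X. kron X (mat_adjoint B * B)"])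
  note BB = mult_carrier_mat[OF mat_adjoint_carrier[OF B] B]
  show "kron (0\<^sub>m d d) (mat_adjoint B * B) = 0\<^sub>m (d * b) (d * b)" by (rule kron_zero_left[OF BB])
  show "kron (X + Y) (mat_adjoint B * B) = kron X (mat_adjoint B * B) + kron Y (mat_adjoint B * B)"
    if "X \<in> carrier_mat d d" "Y \<in> carrier_mat d d" for X Y
    by (rule kron_add_left[OF that BB])
  show "mat_adjoint (kron K B) * kron K B = kron (mat_adjoint K * K) (mat_adjoint B * B)"
    if "dim_col K = d" for K
    unfolding mat_adjoint_kron
    by (rule kron_mult[OF mat_adjoint_carrier mat_adjoint_carrier[OF B] _ B]) (rule carrier_matI[OF refl that])+
qed

section \<open>Rows of a matrix as Kraus operators\<close>

lemma sum_list_upt: "(\<Sum>x\<leftarrow>[0..<n]. f x) = (\<Sum>x<n. f x)"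
  for f :: "nat \<Rightarrow> 'a::comm_monoid_add"
  by (simp add: interv_sum_list_conv_sum_set_nat lessThan_atLeast0)

lemma sum_list_product:
  "(\<Sum>p\<leftarrow>List.product xs ys. f p) = (\<Sum>x\<leftarrow>xs. \<Sum>y\<leftarrow>ys. f (x, y))"
  for f :: "_ \<Rightarrow> 'a::monoid_add"
  by (induction xs) (simp_all add: comp_def)

text \<open>In Dirac notation this is \<open><u| M\<close>: apply \<open>M\<close>, then find the
  register in basis state \<open>u\<close>. Taking all \<open>u\<close> as Kraus operators of one
  outcome discards the register after \<open>M\<close>.\<close>

definition bra :: "complex mat \<Rightarrow> nat \<Rightarrow> complex mat" where
  "bra M u = mat_of_row (row M u)"

lemma bra_carrier [simp]: "M \<in> carrier_mat a b \<Longrightarrow> bra M u \<in> carrier_mat 1 b"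
  by (auto simp: bra_def mat_of_row_def)

lemma bra_dims [simp]: "dim_row (bra M u) = 1" "dim_col (bra M u) = dim_col M"
  by (simp_all add: bra_def mat_of_row_def)

lemma bra_entry [simp]: "u < dim_row M \<Longrightarrow> j < dim_col M \<Longrightarrow> bra M u $$ (0, j) = M $$ (u, j)"
  by (simp add: bra_def mat_of_row_def)

lemma bra_mult:
  assumes A: "A \<in> carrier_mat a b" and B: "B \<in> carrier_mat b c" and u: "u < a"
  shows "bra A u * B = bra (A * B) u"
proof (rule eq_matI)
  fix i j assume "i < dim_row (bra (A * B) u)" "j < dim_col (bra (A * B) u)"
  then have ij: "i = 0" "j < c" using B by auto
  show "(bra A u * B) $$ (i, j) = bra (A * B) u $$ (i, j)"
    using A B u ij mult_mat_entry[OF bra_carrier[OF A] B, of 0 j u] mult_mat_entry[OF A B u ij(2)]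
    by (simp del: index_mult_mat(1))
qed (use A B in auto)

text \<open>The basis projectors \<open>|u><u|\<close> sum to the identity between the adjoint of
  \<open>M\<close> and \<open>M\<close>; forgetting a register thus preserves completeness.\<close>

lemma gram_bra:
  assumes M: "M \<in> carrier_mat a b"
  shows "gram b (map (bra M) [0..<a]) = mat_adjoint M * M" (is "?l = ?r")
proof (rule eq_matI)
  have l: "?l \<in> carrier_mat b b" using M by (intro gram_carrier) auto
  show "dim_row ?l = dim_row ?r" "dim_col ?l = dim_col ?r" using l M by auto
  fix i j assume "i < dim_row ?r" "j < dim_col ?r"
  then have ij: "i < b" "j < b" using M by auto
  have "?l $$ (i, j) = (\<Sum>K\<leftarrow>map (bra M) [0..<a]. \<Sum>k<dim_row K. cnj (K $$ (k, i)) * K $$ (k, j))"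
    using M ij by (intro gram_entry) auto
  also have "\<dots> = (\<Sum>u<a. cnj (bra M u $$ (0, i)) * bra M u $$ (0, j))"
    unfolding map_map comp_def sum_list_upt by simp
  also have "\<dots> = (\<Sum>u<a. mat_adjoint M $$ (i, u) * M $$ (u, j))"
    using M ij by (intro sum.cong) auto
  also have "\<dots> = ?r $$ (i, j)"
    by (rule mult_mat_entry[OF mat_adjoint_carrier[OF M] M ij, symmetric])
  finally show "?l $$ (i, j) = ?r $$ (i, j)" .
qed

section \<open>Errors on single qutrits\<close>

lemma embed_carrier [simp]: "embed n T K \<in> carrier_mat (3 ^ n) (3 ^ n)"
  by (simp add: embed_def)

lemma embed_entry:
  assumes "x < 3 ^ n" "y < 3 ^ n"
  shows "embed n {p} K $$ (x, y)
    = (if \<forall>j<n. j \<noteq> p \<longrightarrow> qutrit j x = qutrit j y then K $$ (qutrit p x, qutrit p y) else 0)"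
proof -
  \<comment> \<open>The exponent of 3 in \<open>subindex {p}\<close> counts the smaller members of
    \<open>{p}\<close>; there are none, so the subindex is the digit itself.\<close>
  have empty: "{i. i = p \<and> i < p} = {}" by auto
  show ?thesis using assms by (auto simp: embed_def subindex_def empty)
qed

text \<open>An operator on no qutrits is a 1 by 1 matrix, so it acts as a scalar.\<close>

lemma embed_empty: "embed n {} K = K $$ (0, 0) \<cdot>\<^sub>m 1\<^sub>m (3 ^ n)"
  by (rule eq_matI) (auto simp: embed_def subindex_def eq_iff_qutrits_eq)

lemma qutrit_less [simp]: "qutrit j x < 3"
  by (simp add: qutrit_def)

lemma All_less_3: "(\<forall>j<3. P j) \<longleftrightarrow> P 0 \<and> P 1 \<and> P (2 :: nat)"
  by (auto simp: numeral_eq_Suc All_less_Suc)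

lemma All_less_4: "(\<forall>j<4. P j) \<longleftrightarrow> (\<forall>j<3. P j) \<and> P (3 :: nat)"
  by (auto simp: numeral_eq_Suc All_less_Suc)

lemma qutrit_add_mult: "qutrit j (r + 3 ^ Suc j * k) = qutrit j r"
proof -
  have "(r + 3 ^ j * (3 * k)) div 3 ^ j = 3 * k + r div 3 ^ j"
    by (rule div_mult_self2) simp
  then show ?thesis by (simp add: qutrit_def mult_ac)
qed

lemma qutrit_mod_27:
  assumes "j < 3" shows "qutrit j (x mod 27) = qutrit j x"
proof -
  \<comment> \<open>What reduction modulo 27 removes is a multiple of \<open>3 ^ Suc j\<close>,
    which digit \<open>j\<close> does not see.\<close>
  have "(27 :: nat) = 3 ^ Suc j * 3 ^ (2 - j)"
    using assms by (simp flip: power_add power_Suc)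
  then have "x = x mod 27 + 3 ^ Suc j * (3 ^ (2 - j) * (x div 27))"
    using mod_mult_div_eq[of x 27] by (metis mult.assoc)
  then show ?thesis using qutrit_add_mult by metis
qed

lemma qutrit_3: "x < 81 \<Longrightarrow> qutrit 3 x = x div 27"
  by (simp add: qutrit_def)

text \<open>Qutrit 3 is the most significant digit \<open>x div 27\<close>, hence the left tensor
  factor; qutrits 0 to 2 form the right factor \<open>x mod 27\<close>.\<close>

lemma embed_last:
  assumes K: "K \<in> carrier_mat 3 3"
  shows "embed 4 {3} K = kron K (1\<^sub>m 27)"
proof (rule eq_matI)
  show "dim_row (embed 4 {3} K) = dim_row (kron K (1\<^sub>m 27))"
    "dim_col (embed 4 {3} K) = dim_col (kron K (1\<^sub>m 27))"
    using K by (auto simp: embed_def kron_def)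
  fix x y assume "x < dim_row (kron K (1\<^sub>m 27))" "y < dim_col (kron K (1\<^sub>m 27))"
  then have xy: "x < 81" "y < 81" using K by (auto simp: kron_def)
  have "(\<forall>j<4. j \<noteq> 3 \<longrightarrow> qutrit j x = qutrit j y) \<longleftrightarrow> (\<forall>j<3. qutrit j (x mod 27) = qutrit j (y mod 27))"
    by (auto simp: All_less_4 qutrit_mod_27)
  also have "\<dots> \<longleftrightarrow> x mod 27 = y mod 27"
    using eq_iff_qutrits_eq[of "x mod 27" 3 "y mod 27"] by simp
  finally show "embed 4 {3} K $$ (x, y) = kron K (1\<^sub>m 27) $$ (x, y)"
    using K xy by (simp add: embed_entry kron_entry[of K 3 3 _ 27 27] qutrit_3)
qed

lemma embed_init:
  assumes p: "p < 3"
  shows "embed 4 {p} K = kron (1\<^sub>m 3) (embed 3 {p} K)"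
proof (rule eq_matI)
  have E: "embed 3 {p} K \<in> carrier_mat 27 27" using embed_carrier[of 3 "{p}" K] by simp
  show "dim_row (embed 4 {p} K) = dim_row (kron (1\<^sub>m 3) (embed 3 {p} K))"
    "dim_col (embed 4 {p} K) = dim_col (kron (1\<^sub>m 3) (embed 3 {p} K))"
    by (auto simp: embed_def kron_def)
  fix x y
  assume "x < dim_row (kron (1\<^sub>m 3) (embed 3 {p} K))" "y < dim_col (kron (1\<^sub>m 3) (embed 3 {p} K))"
  then have xy: "x < 81" "y < 81" by (auto simp: kron_def embed_def)
  have d: "x div 27 < 3" "y div 27 < 3" "x mod 27 < 27" "y mod 27 < 27" using xy by auto
  have agree: "(\<forall>j<4. j \<noteq> p \<longrightarrow> qutrit j x = qutrit j y) \<longleftrightarrow>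
      (\<forall>j<3. j \<noteq> p \<longrightarrow> qutrit j (x mod 27) = qutrit j (y mod 27)) \<and> x div 27 = y div 27"
    using p xy by (auto simp: All_less_4 qutrit_mod_27 qutrit_3)
  have "kron (1\<^sub>m 3) (embed 3 {p} K) $$ (x, y)
    = 1\<^sub>m 3 $$ (x div 27, y div 27) * embed 3 {p} K $$ (x mod 27, y mod 27)"
    using xy by (intro kron_entry[OF one_carrier_mat E]) simp_all
  also have "\<dots> = (if x div 27 = y div 27 then 1 else 0) *
      (if \<forall>j<3. j \<noteq> p \<longrightarrow> qutrit j (x mod 27) = qutrit j (y mod 27)
       then K $$ (qutrit p x, qutrit p y) else 0)"
    using d p embed_entry[of "x mod 27" 3 "y mod 27" p K] by (simp add: qutrit_mod_27) auto
  also have "\<dots> = (if \<forall>j<4. j \<noteq> p \<longrightarrow> qutrit j x = qutrit j y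
      then K $$ (qutrit p x, qutrit p y) else 0)"
    unfolding agree by (simp only: if_distrib mult_1 mult_zero_left split: if_splits) auto
  also have "\<dots> = embed 4 {p} K $$ (x, y)"
    using xy embed_entry[of x 4 y p K] by simp
  finally show "embed 4 {p} K $$ (x, y) = kron (1\<^sub>m 3) (embed 3 {p} K) $$ (x, y)" ..
qed

section \<open>The error-detecting codes\<close>

text \<open>The ternary digits \<open>x\<close>, \<open>x + l\<close>, \<open>x + 2 * l + i\<close>
  sum to \<open>i\<close> modulo 3. So \<open>i\<close> names a coset of the parity-check code of
  distance two, and \<open>l\<close> labels the three classes in it under adding a constant to all
  digits.\<close>

definition codeword :: "nat \<Rightarrow> nat \<Rightarrow> nat \<Rightarrow> nat" where
  "codeword i l x = x + 3 * ((x + l) mod 3) + 9 * ((x + 2 * l + i) mod 3)"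

text \<open>The four sign patterns (\<open>j = 3\<close> is the constant one) form a real tight frame of flat vectors in dimension 3, where no real
  Hadamard matrix exists.  With real code states Bob can use the same code as Alice instead of the
  complex conjugate one.\<close>

definition code_sign :: "nat \<Rightarrow> nat \<Rightarrow> complex" where
  "code_sign j x = (if x = j then -1 else 1)"

text \<open>Row \<open>l\<close> is the code state with label \<open>l\<close>; its transpose is the
  encoder. As the lowest digit of a codeword is \<open>x\<close>, the parameter \<open>x\<close> is
  recovered as \<open>u mod 3\<close>.\<close>

definition decoder :: "nat \<Rightarrow> nat \<Rightarrow> complex mat" where
  "decoder i j = mat 3 27 (\<lambda>(l, u). if u = codeword i l (u mod 3)
     then code_sign j (u mod 3) / complex_of_real (sqrt 3) else 0)"

lemma decoder_carrier [simp]: "decoder i j \<in> carrier_mat 3 27"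
  by (simp add: decoder_def)

lemma codeword_less: "x < 3 \<Longrightarrow> codeword i l x < 27"
proof -
  have "(x + l) mod 3 < 3" "(x + 2 * l + i) mod 3 < 3" by simp_all
  then show "x < 3 \<Longrightarrow> codeword i l x < 27" unfolding codeword_def by linarith
qed

lemma qutrit_codeword:
  assumes "x < 3"
  shows "qutrit 0 (codeword i l x) = x" "qutrit 1 (codeword i l x) = (x + l) mod 3"
    "qutrit 2 (codeword i l x) = (x + 2 * l + i) mod 3"
proof -
  define b c where "b = (x + l) mod 3" and "c = (x + 2 * l + i) mod 3"
  have bc: "b < 3" "c < 3" by (simp_all add: b_def c_def)
  have word: "codeword i l x = x + 3 * (b + 3 * c)" "codeword i l x = (x + 3 * b) + 9 * c"
    by (simp_all add: codeword_def b_def c_def)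
  have "(x + 3 * (b + 3 * c)) mod 3 = x" "(x + 3 * (b + 3 * c)) div 3 = b + 3 * c"
    using assms by (subst mod_mult_self2, simp, subst div_mult_self2, simp_all)
  then show "qutrit 0 (codeword i l x) = x" "qutrit 1 (codeword i l x) = b"
    using bc unfolding word(1) by (simp_all add: qutrit_def del: mod_mult_self4 distrib_left_numeral)
  have "x + 3 * b < 9" using assms bc by linarith
  then have "((x + 3 * b) + 9 * c) div 9 = c" by (subst div_mult_self2) simp_all
  then show "qutrit 2 (codeword i l x) = c"
    using bc unfolding word(2) by (simp add: qutrit_def)
qed

section \<open>Distance and balance of the codes\<close>

lemma codeword_mod: "x < 3 \<Longrightarrow> codeword i l x mod 3 = x"
  using qutrit_codeword(1)[of x i l] by (simp add: qutrit_def)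

text \<open>For fixed \<open>i\<close> the digit sum is fixed modulo 3, so two digits determine the
  third, and they determine \<open>x\<close> and \<open>l\<close>. One altered digit therefore never
  leads from one codeword to another.\<close>

lemma codewords_differ_twice:
  assumes "x < 3" "y < 3" "l < 3" "m < 3" "p < 3"
    and agree: "\<forall>j<3. j \<noteq> p \<longrightarrow> qutrit j (codeword i l x) = qutrit j (codeword i m y)"
  shows "l = m \<and> x = y"
proof -
  \<comment> \<open>Adding \<open>2 * i\<close> turns \<open>i\<close> into a multiple of 3 on both
    sides.\<close>
  have cancel: "a mod 3 = b mod 3" if "(a + i) mod 3 = (b + i) mod 3" for a b :: nat
  proof -
    have "(a + i + 2 * i) mod 3 = (b + i + 2 * i) mod 3"
      using that by (rule mod_add_cong) simp
    then show ?thesis by (simp add: add.assoc)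
  qed
  have cases: "n = 0 \<or> n = 1 \<or> n = 2" if "n < 3" for n :: nat
    using that by auto
  have "(p = 0 \<or> x = y) \<and> (p = 1 \<or> (x + l) mod 3 = (y + m) mod 3) \<and>
      (p = 2 \<or> (x + 2 * l) mod 3 = (y + 2 * m) mod 3)"
    using agree cancel[of "x + 2 * l" "y + 2 * m"]
    unfolding All_less_3 qutrit_codeword[OF assms(1)] qutrit_codeword[OF assms(2)] by argo
  then show ?thesis
    using cases[OF assms(1)] cases[OF assms(2)] cases[OF assms(3)] cases[OF assms(4)]
    by (elim disjE) simp_all
qed

lemma sum_less_3: "(\<Sum>x<3. h x) = h 0 + h 1 + h (2 :: nat)"
  for h :: "nat \<Rightarrow> 'a::comm_monoid_add"
  by (simp add: numeral_eq_Suc)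

lemma sum_rotate: "(\<Sum>x<3. h ((x + c) mod 3)) = (\<Sum>x<3. h x)" for h :: "nat \<Rightarrow> complex"
proof -
  have rotate: "(\<Sum>x<3. h ((x + c mod 3) mod 3)) = (\<Sum>x<3. h x)" if "c mod 3 = r" "r = 0 \<or> r = 1 \<or> r = 2" for r
    using that(2) unfolding that(1) sum_less_3
    by (elim disjE) (simp_all, simp_all add: numeral_2_eq_2 add_ac)
  have "c mod 3 = 0 \<or> c mod 3 = 1 \<or> c mod 3 = 2" by auto
  then have "(\<Sum>x<3. h ((x + c mod 3) mod 3)) = (\<Sum>x<3. h x)" by (rule rotate[OF refl])
  then show ?thesis by (simp only: mod_add_right_eq)
qed

text \<open>At each position the digit is a cyclic shift of \<open>x\<close> and so takes every
  value once. Locally all code states look alike, which keeps an error on one qutrit from learning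
  the label.\<close>

lemma sum_qutrit_codeword:
  fixes h :: "nat \<Rightarrow> complex"
  assumes "p < 3" shows "(\<Sum>x<3. h (qutrit p (codeword i l x))) = (\<Sum>x<3. h x)"
proof -
  have "p = 0 \<or> p = 1 \<or> p = 2" using assms by auto
  then show ?thesis
    using sum_rotate[of h l] sum_rotate[of h "2 * l + i"]
    by (auto simp: qutrit_codeword add.assoc simp del: One_nat_def)
qed

text \<open>Row \<open>l\<close> is supported on just three basis states, the codewords for
  \<open>x < 3\<close>.\<close>

lemma sum_decoder:
  assumes l: "l < 3"
  shows "(\<Sum>u<27. decoder i j $$ (l, u) * g u)
    = (\<Sum>x<3. code_sign j x / complex_of_real (sqrt 3) * g (codeword i l x))"
proof -
  have "(\<Sum>u<27. decoder i j $$ (l, u) * g u)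
    = (\<Sum>u\<in>{u. u < 27 \<and> u = codeword i l (u mod 3)}. code_sign j (u mod 3) / complex_of_real (sqrt 3) * g u)"
    using l by (intro sum.mono_neutral_cong_right) (auto simp: decoder_def)
  also have "\<dots> = (\<Sum>x<3. code_sign j x / complex_of_real (sqrt 3) * g (codeword i l x))"
    by (rule sum.reindex_bij_witness[where i = "codeword i l" and j = "\<lambda>u. u mod 3"])
      (auto simp: codeword_less codeword_mod)
  finally show ?thesis .
qed

text \<open>This is the Knill-Laflamme condition for detecting one error. Distinct codewords are not
  connected since they differ in two places; equal ones contribute the average of the diagonal of
  \<open>K\<close>, independent of the label.\<close>

lemma decoder_detects_error:
  assumes p: "p < 3"
  shows "decoder i j * embed 3 {p} K * transpose_mat (decoder i j)
    = (\<Sum>x<3. K $$ (x, x)) / 3 \<cdot>\<^sub>m 1\<^sub>m 3" (is "?l = ?r")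
proof (rule eq_matI)
  let ?a = "\<lambda>x. code_sign j x / complex_of_real (sqrt 3)" and ?D = "decoder i j"
  have E: "embed 3 {p} K \<in> carrier_mat 27 27" using embed_carrier[of 3 "{p}" K] by simp
  have DE: "?D * embed 3 {p} K \<in> carrier_mat 3 27" using E by (auto simp: decoder_def)
  have DT: "transpose_mat ?D \<in> carrier_mat 27 3" by simp
  show "dim_row ?l = dim_row ?r" "dim_col ?l = dim_col ?r" by (simp_all add: decoder_def)
  fix l m assume "l < dim_row ?r" "m < dim_col ?r"
  then have lm: "l < 3" "m < 3" by auto
  have "?l $$ (l, m) = (\<Sum>w<27. (?D * embed 3 {p} K) $$ (l, w) * transpose_mat ?D $$ (w, m))"
    by (rule mult_mat_entry[OF DE DT lm])
  also have "\<dots> = (\<Sum>w<27. ?D $$ (m, w) * (\<Sum>u<27. ?D $$ (l, u) * embed 3 {p} K $$ (u, w)))"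
    using lm by (intro sum.cong)
      (simp_all add: mult_mat_entry[OF decoder_carrier E] mult.commute carrier_matD[OF decoder_carrier]
        del: index_mult_mat(1))
  also have "\<dots> = (\<Sum>y<3. ?a y * (\<Sum>x<3. ?a x * embed 3 {p} K $$ (codeword i l x, codeword i m y)))"
    by (simp only: sum_decoder lm)
  also have "\<dots> = (\<Sum>y<3. ?a y * (\<Sum>x<3. if l = m \<and> x = y
      then ?a x * K $$ (qutrit p (codeword i l x), qutrit p (codeword i l x)) else 0))"
  proof (intro sum.cong refl arg_cong2[where f = times])
    fix x y :: nat assume "x \<in> {..<3}" "y \<in> {..<3}"
    then have xy: "x < 3" "y < 3" by auto
    show "?a x * embed 3 {p} K $$ (codeword i l x, codeword i m y) = (if l = m \<and> x = y
      then ?a x * K $$ (qutrit p (codeword i l x), qutrit p (codeword i l x)) else 0)"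
      using codewords_differ_twice[OF xy lm p] codeword_less[OF xy(1)] codeword_less[OF xy(2)]
      by (auto simp: embed_entry)
  qed
  also have "\<dots> = (if l = m then \<Sum>y<3. ?a y * ?a y * K $$ (qutrit p (codeword i l y), qutrit p (codeword i l y)) else 0)"
    by (auto simp: mult.assoc intro!: sum.cong)
  \<comment> \<open>The signs square to 1 and the two amplitudes give 1/3.\<close>
  also have "(\<Sum>y<3. ?a y * ?a y * K $$ (qutrit p (codeword i l y), qutrit p (codeword i l y)))
    = (\<Sum>y<3. K $$ (qutrit p (codeword i l y), qutrit p (codeword i l y)) / 3)"
    by (intro sum.cong refl) (simp add: code_sign_def flip: of_real_mult)
  also have "\<dots> = (\<Sum>x<3. K $$ (x, x)) / 3"
    using sum_qutrit_codeword[OF p, of "\<lambda>x. K $$ (x, x)"] by (simp add: sum_divide_distrib[symmetric])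
  finally show "?l $$ (l, m) = ?r $$ (l, m)" using lm by simp
qed

section \<open>Completeness of the code measurements\<close>

lemma embed_one: "p < n \<Longrightarrow> embed n {p} (1\<^sub>m 3) = 1\<^sub>m (3 ^ n)"
proof (rule eq_matI)
  fix x y assume "p < n" "x < dim_row (1\<^sub>m (3 ^ n))" "y < dim_col (1\<^sub>m (3 ^ n))"
  then show "embed n {p} (1\<^sub>m 3) $$ (x, y) = 1\<^sub>m (3 ^ n) $$ (x, y)"
    using eq_iff_qutrits_eq[of x n y] by (auto simp: embed_entry)
qed (auto simp: embed_def)

text \<open>The identity is a trivial error at position 0, with trace 3, so the detection condition
  yields orthonormality of the code states.\<close>

lemma decoder_isometry: "decoder i j * transpose_mat (decoder i j) = 1\<^sub>m 3"
  using decoder_detects_error[of 0 i j "1\<^sub>m 3"] embed_one[of 0 3]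
  by (simp add: right_mult_one_mat[OF decoder_carrier]) (auto simp: lessThan_Suc numeral_eq_Suc)

text \<open>For different \<open>x\<close> and \<open>y\<close> the patterns \<open>j = x\<close>
  and \<open>j = y\<close> contribute -1 and the other two contribute 1.\<close>

lemma sum_code_sign: "(\<Sum>j<4. code_sign j x * code_sign j y) = (if x = y then 4 else 0)"
  if "x < 3" "y < 3"
proof -
  have "x = 0 \<or> x = 1 \<or> x = 2" "y = 0 \<or> y = 1 \<or> y = 2" using that by auto
  then show ?thesis by (auto simp: code_sign_def numeral_eq_Suc)
qed

text \<open>The first two digits of a word determine \<open>l\<close>, and then the third determines
  \<open>i\<close>; each word lies in exactly one class.\<close>

lemma codeword_cover:
  assumes "u < 27"
  shows "(\<Sum>i<3. \<Sum>l<3. if u = codeword i l (u mod 3) then 1 else 0) = (1 :: complex)"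
proof -
  have less: "u mod 3 < 3" by simp
  \<comment> \<open>Comparison digit by digit leaves two conditions, as the lowest digits agree
    automatically.\<close>
  have "u = codeword i l (u mod 3) \<longleftrightarrow> (\<forall>j<3. qutrit j u = qutrit j (codeword i l (u mod 3)))" for i l
    using eq_iff_qutrits_eq[of u 3 "codeword i l (u mod 3)"] assms codeword_less[OF less, of i l] by simp
  then have iff: "u = codeword i l (u mod 3) \<longleftrightarrow>
      qutrit 1 u = (u mod 3 + l) mod 3 \<and> qutrit 2 u = (u mod 3 + 2 * l + i) mod 3" for i l
    unfolding All_less_3 qutrit_codeword[OF less] by (simp add: qutrit_def)
  have "(\<Sum>i<3. \<Sum>l<3. if a = (x + l) mod 3 \<and> b = (x + 2 * l + i) mod 3 then 1 else 0) = (1 :: complex)"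
    if "a < 3" "b < 3" "x < 3" for a b x :: nat
  proof -
    have cases: "n = 0 \<or> n = 1 \<or> n = 2" if "n < 3" for n :: nat using that by auto
    show ?thesis unfolding sum_less_3 using cases[OF that(1)] cases[OF that(2)] cases[OF that(3)]
      by (elim disjE) simp_all
  qed
  from this[of "qutrit 1 u" "qutrit 2 u" "u mod 3"] show ?thesis
    by (simp only: iff qutrit_less less)
qed

text \<open>The \<open>3 * 4\<close> code projections sum to \<open>4 / 3\<close> times the identity, whence the normalisation.\<close>

definition alice_decoder :: "nat \<Rightarrow> nat \<Rightarrow> complex mat" where
  "alice_decoder i j = complex_of_real (sqrt 3) / 2 \<cdot>\<^sub>m decoder i j"

text \<open>Bob's projection for a failed check. The transpose serves as adjoint since the decoder
  is real.\<close>

definition complement :: "nat \<Rightarrow> nat \<Rightarrow> complex mat" where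
  "complement i j = 1\<^sub>m 27 - transpose_mat (decoder i j) * decoder i j"

lemma alice_decoder_carrier [simp]: "alice_decoder i j \<in> carrier_mat 3 27"
  by (simp add: alice_decoder_def)

lemma decoder_projection_carrier:
  "transpose_mat (decoder i j) * decoder i j \<in> carrier_mat 27 27"
  by (rule mult_carrier_mat[OF _ decoder_carrier]) simp

lemma complement_carrier [simp]: "complement i j \<in> carrier_mat 27 27"
  unfolding complement_def by (rule minus_carrier_mat[OF decoder_projection_carrier])

lemma alice_decoder_entry:
  assumes "l < 3" "u < 27"
  shows "alice_decoder i j $$ (l, u)
    = (if u = codeword i l (u mod 3) then code_sign j (u mod 3) / 2 else 0)"
  using assms by (simp add: alice_decoder_def decoder_def)

text \<open>Summing over the sign patterns \<open>j\<close> first removes the off-diagonal terms;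
  the sum over \<open>i\<close> and \<open>l\<close> then counts each basis word once.\<close>

lemma gram_alice_decoders:
  "gram 27 (map (\<lambda>(i, j). alice_decoder i j) (List.product [0..<3] [0..<4])) = 1\<^sub>m 27"
    (is "?l = _")
proof (rule eq_matI)
  have dim: "\<forall>K\<in>set (map (\<lambda>(i, j). alice_decoder i j) (List.product [0..<3] [0..<4])). dim_col K = 27"
    using carrier_matD(2)[OF alice_decoder_carrier] by auto
  show "dim_row ?l = dim_row (1\<^sub>m 27)" "dim_col ?l = dim_col (1\<^sub>m 27)"
    using gram_carrier[OF dim] by simp_all
  fix u w assume "u < dim_row (1\<^sub>m 27)" "w < dim_col (1\<^sub>m 27)"
  then have uw: "u < 27" "w < 27" by auto
  let ?c = "\<lambda>i l u. u = codeword i l (u mod 3)"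
  have "?l $$ (u, w) = (\<Sum>i<3. \<Sum>j<4. \<Sum>l<3. cnj (alice_decoder i j $$ (l, u)) * alice_decoder i j $$ (l, w))"
    unfolding gram_entry[OF dim uw]
    by (simp add: sum_list_product sum_list_upt comp_def carrier_matD(1)[OF alice_decoder_carrier]
        split_def)
  also have "\<dots> = (\<Sum>i<3. \<Sum>j<4. \<Sum>l<3. (if ?c i l u \<and> ?c i l w then 1 else 0) *
      (code_sign j (u mod 3) * code_sign j (w mod 3) / 4))"
    using uw by (intro sum.cong refl) (simp add: alice_decoder_entry code_sign_def)
  also have "\<dots> = (\<Sum>i<3. \<Sum>l<3. (if ?c i l u \<and> ?c i l w then 1 else 0) *
      ((\<Sum>j<4. code_sign j (u mod 3) * code_sign j (w mod 3)) / 4))"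
    by (subst sum.swap[of _ _ "{..<4}"]) (simp add: sum_distrib_left sum_divide_distrib)
  also have "\<dots> = (\<Sum>i<3. \<Sum>l<3. if ?c i l u \<and> u = w then 1 else 0)"
  proof (intro sum.cong refl)
    fix i l :: nat
    have "(\<Sum>j<4. code_sign j (u mod 3) * code_sign j (w mod 3)) = (if u mod 3 = w mod 3 then 4 else 0)"
      by (rule sum_code_sign) simp_all
    \<comment> \<open>Within one class the lowest digit determines the word.\<close>
    moreover have "u = w" if "?c i l u" "?c i l w" "u mod 3 = w mod 3"
      using that by metis
    ultimately show "(if ?c i l u \<and> ?c i l w then 1 else 0) *
        ((\<Sum>j<4. code_sign j (u mod 3) * code_sign j (w mod 3)) / 4)
      = (if ?c i l u \<and> u = w then 1 else 0)"
      by auto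
  qed
  also have "\<dots> = 1\<^sub>m 27 $$ (u, w)"
    using codeword_cover[OF uw(1)] uw by (cases "u = w") simp_all
  finally show "?l $$ (u, w) = 1\<^sub>m 27 $$ (u, w)" .
qed

lemma mat_adjoint_decoder: "mat_adjoint (decoder i j) = transpose_mat (decoder i j)"
  by (rule eq_matI) (auto simp: decoder_def code_sign_def)

text \<open>The encoder maps into the code space, which the complementary projection annihilates.
  Hence Bob's check cannot fail when the first three qutrits are intact.\<close>

lemma complement_decoder: "complement i j * transpose_mat (decoder i j) = 0\<^sub>m 27 3"
proof -
  have D: "decoder i j \<in> carrier_mat 3 27" and T: "transpose_mat (decoder i j) \<in> carrier_mat 27 3"
    by simp_all
  have "complement i j * transpose_mat (decoder i j) = 1\<^sub>m 27 * transpose_mat (decoder i j)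
      - transpose_mat (decoder i j) * decoder i j * transpose_mat (decoder i j)"
    unfolding complement_def by (rule minus_mult_distrib_mat[OF one_carrier_mat decoder_projection_carrier T])
  also have "\<dots> = 0\<^sub>m 27 3"
    unfolding assoc_mult_mat[OF T D T] decoder_isometry left_mult_one_mat[OF T] right_mult_one_mat[OF T]
    by (rule minus_r_inv_mat[OF T])
  finally show ?thesis .
qed

text \<open>An orthogonal projection is self-adjoint and idempotent; idempotence follows from
  \<open>complement_decoder\<close>.\<close>

lemma gram_complement: "mat_adjoint (complement i j) * complement i j = complement i j"
proof -
  let ?D = "decoder i j"
  have D: "?D \<in> carrier_mat 3 27" and T: "transpose_mat ?D \<in> carrier_mat 27 3"
    by simp_all
  have "mat_adjoint (transpose_mat ?D * ?D) = transpose_mat ?D * ?D"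
    unfolding mat_adjoint_mult[OF T D]
    by (simp only: mat_adjoint_decoder[symmetric] mat_adjoint_mat_adjoint)
  then have "mat_adjoint (complement i j) = complement i j"
    unfolding complement_def
    by (simp only: mat_adjoint_minus[OF one_carrier_mat decoder_projection_carrier] mat_adjoint_one)
  moreover have "complement i j * complement i j = complement i j * 1\<^sub>m 27
      - complement i j * (transpose_mat ?D * ?D)"
    by (subst (2) complement_def) (rule mult_minus_distrib_mat[OF complement_carrier one_carrier_mat decoder_projection_carrier])
  moreover have "complement i j * (transpose_mat ?D * ?D) = 0\<^sub>m 27 27"
    using D by (simp only: assoc_mult_mat[OF complement_carrier T D, symmetric] complement_decoder left_mult_zero_mat)
  moreover have "complement i j - 0\<^sub>m 27 27 = complement i j"
    using carrier_matD[OF complement_carrier[of i j]] by (intro eq_matI) auto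
  ultimately show ?thesis by (simp only: right_mult_one_mat[OF complement_carrier])
qed

section \<open>The protocol\<close>

text \<open>Alice then holds qutrit 3 as left factor and the decoded qutrit as right factor. The
  single outcome is the partial trace over the left one.\<close>

definition keep_logical :: protocol where
  "keep_logical = Alice [(3, map (\<lambda>K. kron K (1\<^sub>m 3)) (map (bra (1\<^sub>m 3)) [0..<3]), Output 1)]"

text \<open>Here the partial trace is over the decoded qutrit, and qutrit 3 survives.\<close>

definition keep_last :: protocol where
  "keep_last = Alice [(3, map (kron (1\<^sub>m 3)) (map (bra (1\<^sub>m 3)) [0..<3]), Output 1)]"

text \<open>If the check succeeds, Bob drops qutrit 3 and decodes the block; if it fails, he drops
  the projected block and keeps qutrit 3. Alice's choice of register must wait for this message, so
  communication in both directions occurs.\<close>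

definition bob_step :: "nat \<Rightarrow> nat \<Rightarrow> protocol" where
  "bob_step i j = Bob
     [(3, map (\<lambda>K. kron K (decoder i j)) (map (bra (1\<^sub>m 3)) [0..<3]), keep_logical),
      (3, map (kron (1\<^sub>m 3)) (map (bra (complement i j)) [0..<27]), keep_last)]"

definition purification_protocol :: protocol where
  "purification_protocol = Alice (map (\<lambda>(i, j). (9, [kron (1\<^sub>m 3) (alice_decoder i j)], bob_step i j))
     (List.product [0..<3] [0..<4]))"

section \<open>The protocol is a valid 2-EPP\<close>

lemma gram_bra_one: "gram n (map (bra (1\<^sub>m n)) [0..<n]) = 1\<^sub>m n"
  unfolding gram_bra[OF one_carrier_mat] mat_adjoint_one by simp

lemma kron_bra_carriers:
  assumes "M \<in> carrier_mat a b" "B \<in> carrier_mat c d"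
  shows "kron (bra M u) B \<in> carrier_mat c (b * d)" "kron B (bra M u) \<in> carrier_mat c (d * b)"
  using kron_carrier[OF bra_carrier[OF assms(1)] assms(2)] kron_carrier[OF assms(2) bra_carrier[OF assms(1)]]
  by simp_all

lemma wf_keep_logical: "wf_protocol 9 3 keep_logical"
proof -
  have "gram (3 * 3) (map (\<lambda>K. kron K (1\<^sub>m 3)) (map (bra (1\<^sub>m 3)) [0..<3])) = 1\<^sub>m (3 * 3)"
    by (subst gram_kron_left[OF one_carrier_mat]) (auto simp: gram_bra_one mat_adjoint_one kron_one)
  moreover have "kron (bra (1\<^sub>m 3) u) (1\<^sub>m 3) \<in> carrier_mat 3 9" for u
    using kron_bra_carriers(1)[OF one_carrier_mat[of 3] one_carrier_mat[of 3]] by simp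
  ultimately show ?thesis
    by (auto simp: keep_logical_def instrument_def trace_preserving_iff_gram)
qed

lemma wf_keep_last: "wf_protocol 9 3 keep_last"
proof -
  have "gram (3 * 3) (map (kron (1\<^sub>m 3)) (map (bra (1\<^sub>m 3)) [0..<3])) = 1\<^sub>m (3 * 3)"
    by (subst gram_kron_right[OF one_carrier_mat]) (auto simp: gram_bra_one mat_adjoint_one kron_one)
  moreover have "kron (1\<^sub>m 3) (bra (1\<^sub>m 3) u) \<in> carrier_mat 3 9" for u
    using kron_bra_carriers(2)[OF one_carrier_mat[of 3] one_carrier_mat[of 3]] by simp
  ultimately show ?thesis
    by (auto simp: keep_last_def instrument_def trace_preserving_iff_gram)
qed

text \<open>The two outcomes contribute the code projection and its complement, each tensored with
  the identity on qutrit 3.\<close>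

lemma wf_bob_step: "wf_protocol 9 81 (bob_step i j)"
proof -
  let ?D = "decoder i j" and ?C = "complement i j"
  let ?Ks = "map (\<lambda>K. kron K ?D) (map (bra (1\<^sub>m 3)) [0..<3])"
    and ?Ls = "map (kron (1\<^sub>m 3)) (map (bra ?C) [0..<27])"
  have carrier: "kron (bra (1\<^sub>m 3) u) ?D \<in> carrier_mat 3 81" "kron (1\<^sub>m 3) (bra ?C u) \<in> carrier_mat 3 81" for u
    using kron_bra_carriers(1)[OF one_carrier_mat[of 3] decoder_carrier]
      kron_bra_carriers(2)[OF complement_carrier one_carrier_mat[of 3]] by simp_all
  have "gram (3 * 27) (?Ks @ ?Ls) = gram (3 * 27) ?Ks + gram (3 * 27) ?Ls"
    using carrier by (intro gram_append) auto
  also have "gram (3 * 27) ?Ks = kron (1\<^sub>m 3) (transpose_mat ?D * ?D)"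
    by (subst gram_kron_left[OF decoder_carrier]) (auto simp: gram_bra_one mat_adjoint_decoder)
  also have "gram (3 * 27) ?Ls = kron (1\<^sub>m 3) ?C"
    using carrier_matD(2)[OF complement_carrier]
    by (subst gram_kron_right[OF one_carrier_mat])
      (auto simp: mat_adjoint_one gram_bra[OF complement_carrier] gram_complement)
  also have "kron (1\<^sub>m 3) (transpose_mat ?D * ?D) + kron (1\<^sub>m 3) ?C = kron (1\<^sub>m 3) (transpose_mat ?D * ?D + ?C)"
    by (rule kron_add_right[OF one_carrier_mat decoder_projection_carrier complement_carrier, symmetric])
  also have "transpose_mat ?D * ?D + ?C = 1\<^sub>m 27"
    using carrier_matD[OF decoder_projection_carrier[of i j]] unfolding complement_def
    by (intro eq_matI) (auto simp del: index_mult_mat)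
  finally have "gram 81 (?Ks @ ?Ls) = 1\<^sub>m 81" by (simp add: kron_one)
  then show ?thesis using carrier wf_keep_logical wf_keep_last
    by (auto simp: bob_step_def instrument_def trace_preserving_iff_gram)
qed

lemma two_epp_purification_protocol: "two_epp 4 purification_protocol"
proof -
  let ?Ks = "map (\<lambda>(i, j). alice_decoder i j) (List.product [0..<3] [0..<4])"
  have "concat (map (\<lambda>(d, Ks, P). Ks) (map (\<lambda>(i, j). (9 :: nat, [kron (1\<^sub>m 3) (alice_decoder i j)], bob_step i j))
     (List.product [0..<3] [0..<4]))) = map (kron (1\<^sub>m 3)) ?Ks" (is "?c = _")
    by (simp add: comp_def split_def concat_map_singleton)
  moreover have "gram (3 * 27) (map (kron (1\<^sub>m 3)) ?Ks) = 1\<^sub>m (3 * 27)"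
    using carrier_matD(2)[OF alice_decoder_carrier]
    by (subst gram_kron_right[OF one_carrier_mat, where d = 27]) (auto simp: gram_alice_decoders mat_adjoint_one kron_one)
  ultimately have "trace_preserving 81 ?c" by (simp add: trace_preserving_iff_gram)
  moreover have "kron (1\<^sub>m 3) (alice_decoder i j) \<in> carrier_mat 9 81" for i j
    using kron_carrier[OF one_carrier_mat[of 3] alice_decoder_carrier[of i j]] by simp
  ultimately show ?thesis
    unfolding two_epp_def purification_protocol_def wf_protocol.simps instrument_def
    using wf_bob_step by auto
qed

section \<open>Correctness\<close>

text \<open>Coefficient matrices are followed only up to a scalar, since normalisation takes place
  at the very end.\<close>

definition rays :: "complex mat set \<Rightarrow> complex vec set" where
  "rays NS = {c \<cdot>\<^sub>v bipartite N | c N. N \<in> NS}"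

lemma rays_carrier: "NS \<subseteq> carrier_mat b a \<Longrightarrow> rays NS \<subseteq> carrier_vec (a * b)"
  unfolding rays_def by auto

lemma kron_mult_ray:
  assumes A: "A \<in> carrier_mat a' a" and B: "B \<in> carrier_mat b' b" and N: "N \<in> carrier_mat b a"
  shows "kron A B *\<^sub>v (c \<cdot>\<^sub>v bipartite N) = c \<cdot>\<^sub>v bipartite (B * N * transpose_mat A)"
  using mult_mat_vec[OF kron_carrier[OF A B] bipartite_carrier[OF N]] kron_mult_bipartite[OF A B N]
  by simp

text \<open>One move of Alice on coefficient matrices: multiplication on the right by a transposed
  Kraus operator. \<open>bob_mixture\<close> is the counterpart on the left.\<close>

lemma alice_mixture:
  assumes \<rho>: "\<rho> \<in> mixtures (a * b) (rays NS)" and NS: "NS \<subseteq> carrier_mat b a"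
    and Ks: "set Ks \<subseteq> carrier_mat a' a"
    and NS': "\<And>K N. K \<in> set Ks \<Longrightarrow> N \<in> NS \<Longrightarrow> N * transpose_mat K \<in> NS'" "NS' \<subseteq> carrier_mat b a'"
  shows "apply_kraus (a' * b) (map (\<lambda>K. kron K (1\<^sub>m b)) Ks) \<rho> \<in> mixtures (a' * b) (rays NS')"
proof (rule apply_kraus_mixture[OF \<rho> rays_carrier[OF NS] _ rays_carrier[OF NS'(2)]])
  show "set (map (\<lambda>K. kron K (1\<^sub>m b)) Ks) \<subseteq> carrier_mat (a' * b) (a * b)"
    using Ks by auto
  fix L v assume "L \<in> set (map (\<lambda>K. kron K (1\<^sub>m b)) Ks)" "v \<in> rays NS"
  then obtain K c N where K: "L = kron K (1\<^sub>m b)" "K \<in> set Ks" and N: "v = c \<cdot>\<^sub>v bipartite N" "N \<in> NS"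
    by (auto simp: rays_def)
  have "K \<in> carrier_mat a' a" "N \<in> carrier_mat b a" using K N Ks NS by auto
  then have "L *\<^sub>v v = c \<cdot>\<^sub>v bipartite (N * transpose_mat K)"
    unfolding K N using kron_mult_ray[of K a' a "1\<^sub>m b" b b N c] by simp
  then show "L *\<^sub>v v \<in> rays NS'" using NS'(1)[OF K(2) N(2)] unfolding rays_def by blast
qed

lemma bob_mixture:
  assumes \<rho>: "\<rho> \<in> mixtures (a * b) (rays NS)" and NS: "NS \<subseteq> carrier_mat b a"
    and Ks: "set Ks \<subseteq> carrier_mat b' b"
    and NS': "\<And>K N. K \<in> set Ks \<Longrightarrow> N \<in> NS \<Longrightarrow> K * N \<in> NS'" "NS' \<subseteq> carrier_mat b' a"
  shows "apply_kraus (a * b') (map (\<lambda>K. kron (1\<^sub>m a) K) Ks) \<rho> \<in> mixtures (a * b') (rays NS')"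
proof (rule apply_kraus_mixture[OF \<rho> rays_carrier[OF NS] _ rays_carrier[OF NS'(2)]])
  show "set (map (\<lambda>K. kron (1\<^sub>m a) K) Ks) \<subseteq> carrier_mat (a * b') (a * b)"
    using Ks by auto
  fix L v assume "L \<in> set (map (\<lambda>K. kron (1\<^sub>m a) K) Ks)" "v \<in> rays NS"
  then obtain K c N where K: "L = kron (1\<^sub>m a) K" "K \<in> set Ks" and N: "v = c \<cdot>\<^sub>v bipartite N" "N \<in> NS"
    by (auto simp: rays_def)
  have KN: "K \<in> carrier_mat b' b" "N \<in> carrier_mat b a" using K N Ks NS by auto
  then have "L *\<^sub>v v = c \<cdot>\<^sub>v bipartite (K * N)"
    unfolding K N using kron_mult_ray[of "1\<^sub>m a" a a K b' b N c] mult_carrier_mat[OF KN]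
    by (simp add: right_mult_one_mat[of _ b' a])
  then show "L *\<^sub>v v \<in> rays NS'" using NS'(1)[OF K(2) N(2)] unfolding rays_def by blast
qed

text \<open>\<open>K\<close> acts on qutrit 3 and \<open>F\<close> on the block of the first three.
  The conditions are what the two branches use, so both error locations are treated
  uniformly.\<close>

definition detectable :: "complex mat \<Rightarrow> bool" where
  "detectable E \<longleftrightarrow> (\<exists>K F. K \<in> carrier_mat 3 3 \<and> F \<in> carrier_mat 27 27 \<and> E = kron K F \<and>
     (K = 1\<^sub>m 3 \<or> F = 1\<^sub>m 27) \<and>
     (\<forall>i j. \<exists>c. decoder i j * F * transpose_mat (decoder i j) = c \<cdot>\<^sub>m 1\<^sub>m 3))"

lemma detectable_carrier:
  assumes "detectable E" shows "E \<in> carrier_mat 81 81"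
proof -
  obtain K F where "K \<in> carrier_mat 3 3" "F \<in> carrier_mat 27 27" "E = kron K F"
    using assms unfolding detectable_def by (elim exE conjE) (rule that)
  then show ?thesis using kron_carrier[of K 3 3 F 27 27] by simp
qed

section \<open>Errors on at most one of the four qutrits\<close>

lemma decoder_one: "decoder i j * 1\<^sub>m 27 * transpose_mat (decoder i j) = 1 \<cdot>\<^sub>m 1\<^sub>m 3"
  unfolding right_mult_one_mat[OF decoder_carrier] decoder_isometry by (intro eq_matI) auto

lemma detectable_last:
  assumes "K \<in> carrier_mat 3 3" shows "detectable (kron K (1\<^sub>m 27))"
  unfolding detectable_def
  by (intro exI[of _ K] exI[of _ "1\<^sub>m 27"] conjI allI disjI2 refl one_carrier_mat assms)
    (rule exI, rule decoder_one)

lemma detectable_init: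
  assumes "p < 3" shows "detectable (kron (1\<^sub>m 3) (embed 3 {p} K))"
proof -
  have "embed 3 {p} K \<in> carrier_mat 27 27" using embed_carrier[of 3 "{p}" K] by simp
  then show ?thesis
    unfolding detectable_def
    by (intro exI[of _ "1\<^sub>m 3"] exI[of _ "embed 3 {p} K"] conjI allI disjI1 refl one_carrier_mat)
      (assumption, rule exI, rule decoder_detects_error[OF assms])
qed

lemma detectable_embed:
  assumes T: "T \<subseteq> {..<4}" "card T \<le> 1" and K: "K \<in> carrier_mat (3 ^ card T) (3 ^ card T)"
  shows "detectable (embed 4 T K)"
proof (cases "T = {}")
  case True
  \<comment> \<open>With no affected position the error is a scalar, which is put into the factor of
    qutrit 3.\<close>
  have "embed 4 T K = kron (K $$ (0, 0) \<cdot>\<^sub>m 1\<^sub>m 3) (1\<^sub>m 27)"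
    unfolding True embed_empty by (rule eq_matI) (auto simp: kron_def less_mult_imp_div_less
        dest: div_mod_eq_iff[THEN iffD1, OF conjI])
  then show ?thesis using detectable_last by simp
next
  case False
  have "finite T" using T(1) finite_subset by blast
  with False have "card T = 1" using T(2) card_gt_0_iff[of T] by linarith
  then obtain p where p: "T = {p}" using card_1_singletonE by blast
  then have "p < 3 \<or> p = 3" using T(1) by auto
  then show ?thesis
  proof
    assume "p < 3"
    then show ?thesis unfolding p embed_init[OF \<open>p < 3\<close>] by (rule detectable_init)
  next
    assume "p = 3"
    have "K \<in> carrier_mat 3 3" using K by (simp add: p)
    then show ?thesis unfolding p \<open>p = 3\<close> embed_last[OF \<open>K \<in> carrier_mat 3 3\<close>] by (rule detectable_last)
  qed
qed

text \<open>The noiseless coefficient matrix is a multiple of the identity, so the noise on Bob's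
  side turns it into the error operators themselves.\<close>

lemma noisy_epr_pairs_mixture:
  assumes T: "T \<subseteq> {..<4}" "card T \<le> 1" and Ks: "set Ks \<subseteq> carrier_mat (3 ^ card T) (3 ^ card T)"
  shows "noisy_epr_pairs 4 T Ks \<in> mixtures (81 * 81) (rays {E. detectable E})"
proof -
  have epr: "epr_pairs 4 \<in> rays {1\<^sub>m 81}"
    unfolding rays_def
    by (intro CollectI exI conjI singletonI) (simp only: epr_pairs_eq_bipartite bipartite_smult, simp)
  have one: "{1\<^sub>m 81} \<subseteq> carrier_mat 81 81" by simp
  have pure: "pure_state (epr_pairs 4) \<in> mixtures (81 * 81) (rays {1\<^sub>m 81})"
    by (rule pure_state_in_mixtures[OF epr subsetD[OF rays_carrier[OF one] epr]])
  have Ls: "set (map (embed 4 T) Ks) \<subseteq> carrier_mat 81 81" using embed_carrier[of 4 T] by auto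
  have detect: "{E. detectable E} \<subseteq> carrier_mat 81 81" by (intro subsetI detectable_carrier) simp
  have step: "L * N \<in> {E. detectable E}" if "L \<in> set (map (embed 4 T) Ks)" and N: "N \<in> {1\<^sub>m 81}" for L N
  proof -
    obtain K where K: "L = embed 4 T K" "K \<in> set Ks" using \<open>L \<in> _\<close> by auto
    have L: "detectable L" unfolding K(1) by (rule detectable_embed[OF T subsetD[OF Ks K(2)]])
    have "L * N = L"
      unfolding singletonD[OF N] by (rule right_mult_one_mat[OF detectable_carrier[OF L]])
    then show ?thesis using L by simp
  qed
  have dims: "(3 :: nat) ^ 4 = 81" by simp
  show ?thesis
    using bob_mixture[OF pure one Ls step detect]
    unfolding noisy_epr_pairs_def dims map_map comp_def .
qed

section \<open>Both branches end in multiples of the identity, the coefficient matrices of an EPR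
  pair\<close>

definition error_free :: "complex mat set" where
  "error_free = {c \<cdot>\<^sub>m 1\<^sub>m 3 | c. True}"

text \<open>The mixed-product rule separates the discarded qutrit 3, which leaves only a number,
  from the block, where the detection condition gives a multiple of the identity. Alice's and Bob's
  discarded values \<open>q\<close> and \<open>p\<close> may differ.\<close>

lemma keep_logical_correct:
  assumes E: "detectable E" and p: "p < 3" and q: "q < 3"
  shows "kron (bra (1\<^sub>m 3) p) (decoder i j) * (E * transpose_mat (kron (1\<^sub>m 3) (alice_decoder i j)))
    * transpose_mat (kron (bra (1\<^sub>m 3) q) (1\<^sub>m 3)) \<in> error_free"
proof -
  let ?D = "decoder i j" and ?A = "transpose_mat (alice_decoder i j)"
  let ?p = "bra (1\<^sub>m 3) p :: complex mat" and ?q = "transpose_mat (bra (1\<^sub>m 3) q) :: complex mat"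
  obtain K F c where K: "K \<in> carrier_mat 3 3" and F: "F \<in> carrier_mat 27 27" and KF: "E = kron K F"
    and c: "?D * F * transpose_mat ?D = c \<cdot>\<^sub>m 1\<^sub>m 3"
    using E unfolding detectable_def by blast
  have A: "?A \<in> carrier_mat 27 3" and T: "transpose_mat ?D \<in> carrier_mat 27 3" by simp_all
  have P: "?p \<in> carrier_mat 1 3" and Q: "?q \<in> carrier_mat 3 1"
    unfolding transpose_carrier_mat by (rule bra_carrier[OF one_carrier_mat])+
  note FA = mult_carrier_mat[OF F A] and DF = mult_carrier_mat[OF decoder_carrier F]
  note DFA = mult_carrier_mat[OF decoder_carrier FA] and PK = mult_carrier_mat[OF P K]
  have "?D * (F * ?A) = complex_of_real (sqrt 3) / 2 \<cdot>\<^sub>m (?D * F * transpose_mat ?D)"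
    unfolding alice_decoder_def transpose_mat_smult
      mult_smult_distrib[OF F T] mult_smult_distrib[OF decoder_carrier mult_carrier_mat[OF F T]]
      assoc_mult_mat[OF decoder_carrier F T] ..
  then have D: "?D * (F * ?A) = complex_of_real (sqrt 3) / 2 * c \<cdot>\<^sub>m 1\<^sub>m 3"
    unfolding c by (intro eq_matI) auto
  have "kron ?p ?D * (E * kron (1\<^sub>m 3) ?A) * kron ?q (1\<^sub>m 3) = kron (?p * K * ?q) (?D * (F * ?A))"
    unfolding KF kron_mult[OF K F one_carrier_mat A] right_mult_one_mat[OF K]
      kron_mult[OF P decoder_carrier K FA] kron_mult[OF PK DFA Q one_carrier_mat]
      right_mult_one_mat[OF DFA] ..
  also have "\<dots> = (?p * K * ?q) $$ (0, 0) \<cdot>\<^sub>m (?D * (F * ?A))"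
    by (rule kron_scalar_left[OF mult_carrier_mat[OF PK Q]])
  also have "\<dots> = (?p * K * ?q) $$ (0, 0) * (complex_of_real (sqrt 3) / 2 * c) \<cdot>\<^sub>m 1\<^sub>m 3"
    unfolding D by (intro eq_matI) auto
  finally show ?thesis
    unfolding kron_transpose transpose_one error_free_def by blast
qed

text \<open>The block leaves only an amplitude in front of \<open>K\<close>. Either the block is
  intact and this amplitude is zero, or \<open>K\<close> is the identity.\<close>

lemma keep_last_correct:
  assumes E: "detectable E" and u: "u < 27" and l: "l < 3"
  shows "kron (1\<^sub>m 3) (bra (complement i j) u) * (E * transpose_mat (kron (1\<^sub>m 3) (alice_decoder i j)))
    * transpose_mat (kron (1\<^sub>m 3) (bra (1\<^sub>m 3) l)) \<in> error_free"
proof -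
  let ?D = "decoder i j" and ?A = "transpose_mat (alice_decoder i j)" and ?C = "complement i j"
  let ?u = "bra ?C u" and ?l = "transpose_mat (bra (1\<^sub>m 3) l) :: complex mat"
  obtain K F where K: "K \<in> carrier_mat 3 3" and F: "F \<in> carrier_mat 27 27" and KF: "E = kron K F"
    and triv: "K = 1\<^sub>m 3 \<or> F = 1\<^sub>m 27"
    using E unfolding detectable_def by blast
  have A: "?A \<in> carrier_mat 27 3" and T: "transpose_mat ?D \<in> carrier_mat 27 3" by simp_all
  have U: "?u \<in> carrier_mat 1 27" and L: "?l \<in> carrier_mat 3 1"
    unfolding transpose_carrier_mat by (rule bra_carrier[OF complement_carrier] bra_carrier[OF one_carrier_mat])+
  note FA = mult_carrier_mat[OF F A]
  note UFA = mult_carrier_mat[OF U FA]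
  have "kron (1\<^sub>m 3) ?u * (E * kron (1\<^sub>m 3) ?A) * kron (1\<^sub>m 3) ?l = kron K (?u * (F * ?A) * ?l)"
    unfolding KF kron_mult[OF K F one_carrier_mat A] right_mult_one_mat[OF K]
      kron_mult[OF one_carrier_mat U K FA] left_mult_one_mat[OF K] kron_mult[OF K UFA one_carrier_mat L]
      right_mult_one_mat[OF K] ..
  also have "\<dots> = (?u * (F * ?A) * ?l) $$ (0, 0) \<cdot>\<^sub>m K"
    by (rule kron_scalar_right[OF mult_carrier_mat[OF UFA L]])
  also have "\<dots> \<in> error_free"
  proof (cases "F = 1\<^sub>m 27")
    case True
    \<comment> \<open>With an intact block Bob's failure operator meets Alice's code state directly
      and kills it.\<close>
    have CA: "?C * ?A = 0\<^sub>m 27 3"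
      unfolding alice_decoder_def transpose_mat_smult mult_smult_distrib[OF complement_carrier T]
        complement_decoder by (intro eq_matI) auto
    have "?u * (F * ?A) = bra (0\<^sub>m 27 3) u"
      unfolding True left_mult_one_mat[OF A] bra_mult[OF complement_carrier A u] CA ..
    also have "\<dots> = 0\<^sub>m 1 3"
      using u by (intro eq_matI) auto
    finally have "?u * (F * ?A) * ?l = 0\<^sub>m 1 1" using L by simp
    \<comment> \<open>A branch of amplitude zero counts as error-free with factor 0, whatever
      \<open>K\<close> is.\<close>
    then have "(?u * (F * ?A) * ?l) $$ (0, 0) \<cdot>\<^sub>m K = 0 \<cdot>\<^sub>m 1\<^sub>m 3"
      using K by (intro eq_matI) auto
    then show ?thesis unfolding error_free_def by blast
  next
    case False
    then have "K = 1\<^sub>m 3" using triv by simp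
    then show ?thesis unfolding error_free_def by blast
  qed
  finally show ?thesis unfolding kron_transpose transpose_one .
qed

lemma error_free_carrier: "error_free \<subseteq> carrier_mat 3 3"
  by (auto simp: error_free_def)

text \<open>The tree is followed through Alice's measurement, Bob's check and Alice's discarding.
  The resulting matrix products are those of \<open>keep_logical_correct\<close> and
  \<open>keep_last_correct\<close>.\<close>

lemma results_purification_protocol:
  assumes \<rho>: "\<rho> \<in> mixtures (81 * 81) (rays {E. detectable E})"
    and res: "(m, \<sigma>) \<in> set (results 81 81 purification_protocol \<rho>)"
  shows "m = 1 \<and> \<sigma> \<in> mixtures (3 * 3) (rays error_free)"
proof -
  let ?L = "map (\<lambda>K. kron K (1\<^sub>m 3)) (map (bra (1\<^sub>m 3)) [0..<3]) :: complex mat list"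
  let ?Q = "map (kron (1\<^sub>m 3)) (map (bra (1\<^sub>m 3)) [0..<3]) :: complex mat list"
  obtain i j where "(m, \<sigma>) \<in> set (results 9 81 (bob_step i j)
      (apply_kraus (9 * 81) (map (\<lambda>K. kron K (1\<^sub>m 81)) [kron (1\<^sub>m 3) (alice_decoder i j)]) \<rho>))"
    using res unfolding purification_protocol_def by auto
  moreover define \<rho>1 where "\<rho>1 =
    apply_kraus (9 * 81) (map (\<lambda>K. kron K (1\<^sub>m 81)) [kron (1\<^sub>m 3) (alice_decoder i j)]) \<rho>"
  ultimately have res1: "(m, \<sigma>) \<in> set (results 9 81 (bob_step i j) \<rho>1)" by simp
  let ?A = "transpose_mat (kron (1\<^sub>m 3) (alice_decoder i j))"
  let ?S1 = "{E * ?A | E. detectable E}"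
  have AK: "kron (1\<^sub>m 3) (alice_decoder i j) \<in> carrier_mat 9 81"
    using kron_carrier[OF one_carrier_mat[of 3] alice_decoder_carrier[of i j]] by simp
  then have S1: "?S1 \<subseteq> carrier_mat 81 9"
    using mult_carrier_mat[OF detectable_carrier transpose_carrier_mat[THEN iffD2, OF AK]] by auto
  have \<rho>1: "\<rho>1 \<in> mixtures (9 * 81) (rays ?S1)"
    unfolding \<rho>1_def using AK S1 detectable_carrier by (intro alice_mixture[OF \<rho>]) auto
  let ?BL = "map (\<lambda>K. kron K (decoder i j)) (map (bra (1\<^sub>m 3)) [0..<3])"
  let ?BQ = "map (kron (1\<^sub>m 3)) (map (bra (complement i j)) [0..<27])"
  let ?S2 = "\<lambda>Bs. {B * (E * ?A) | B E. B \<in> set Bs \<and> detectable E}"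
  \<comment> \<open>Bob's check and Alice's discarding, stated once for both branches;
    \<open>Bs\<close> and \<open>As\<close> are their Kraus operators.\<close>
  have step: "apply_kraus (3 * 3) (map (\<lambda>K. kron K (1\<^sub>m 3)) As)
      (apply_kraus (9 * 3) (map (\<lambda>K. kron (1\<^sub>m 9) K) Bs) \<rho>1) \<in> mixtures (3 * 3) (rays error_free)"
    if Bs: "set Bs \<subseteq> carrier_mat 3 81" and As: "set As \<subseteq> carrier_mat 3 9"
      and correct: "\<And>A B E. A \<in> set As \<Longrightarrow> B \<in> set Bs \<Longrightarrow> detectable E \<Longrightarrow>
        B * (E * ?A) * transpose_mat A \<in> error_free" for As Bs
  proof -
    have S2: "?S2 Bs \<subseteq> carrier_mat 3 9" using Bs S1 mult_carrier_mat by blast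
    have "apply_kraus (9 * 3) (map (\<lambda>K. kron (1\<^sub>m 9) K) Bs) \<rho>1 \<in> mixtures (9 * 3) (rays (?S2 Bs))"
      using S2 by (intro bob_mixture[OF \<rho>1 S1 Bs]) auto
    then show ?thesis
      by (rule alice_mixture[OF _ S2 As _ error_free_carrier]) (use correct in auto)
  qed
  have carriers: "set ?BL \<subseteq> carrier_mat 3 81" "set ?BQ \<subseteq> carrier_mat 3 81"
      "set ?L \<subseteq> carrier_mat 3 9" "set ?Q \<subseteq> carrier_mat 3 9"
    using kron_bra_carriers(1)[OF one_carrier_mat[of 3] decoder_carrier[of i j]]
      kron_bra_carriers(2)[OF complement_carrier[of i j] one_carrier_mat[of 3]]
      kron_bra_carriers[OF one_carrier_mat[of 3] one_carrier_mat[of 3]] by auto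
  have "apply_kraus (3 * 3) (map (\<lambda>K. kron K (1\<^sub>m 3)) ?L)
      (apply_kraus (9 * 3) (map (\<lambda>K. kron (1\<^sub>m 9) K) ?BL) \<rho>1) \<in> mixtures (3 * 3) (rays error_free)"
    using keep_logical_correct by (intro step carriers) auto
  moreover have "apply_kraus (3 * 3) (map (\<lambda>K. kron K (1\<^sub>m 3)) ?Q)
      (apply_kraus (9 * 3) (map (\<lambda>K. kron (1\<^sub>m 9) K) ?BQ) \<rho>1) \<in> mixtures (3 * 3) (rays error_free)"
    using keep_last_correct by (intro step carriers) auto
  ultimately show ?thesis
    using res1 unfolding bob_step_def keep_logical_def keep_last_def results.simps by auto
qed

text \<open>All vectors in the mixture are multiples of one EPR vector, so the mixture is a multiple
  of a single projector.\<close>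

lemma normalized_error_free_mixture:
  assumes \<sigma>: "\<sigma> \<in> mixtures (3 * 3) (rays error_free)" and tr: "mtrace \<sigma> \<noteq> 0"
  shows "(1 / mtrace \<sigma>) \<cdot>\<^sub>m \<sigma> = pure_state (epr_pairs 1)"
proof -
  have epr: "epr_pairs 1 = 1 / complex_of_real (sqrt 3) \<cdot>\<^sub>v bipartite (1\<^sub>m 3)"
    using epr_pairs_eq_bipartite[of 1] by (simp add: bipartite_smult)
  have "rays error_free \<subseteq> {c \<cdot>\<^sub>v epr_pairs 1 | c. True}"
  proof
    fix v assume "v \<in> rays error_free"
    then obtain c d where "v = c \<cdot>\<^sub>v (d \<cdot>\<^sub>v bipartite (1\<^sub>m 3))"
      by (auto simp: rays_def error_free_def bipartite_smult)
    then have "v = (c * d * complex_of_real (sqrt 3)) \<cdot>\<^sub>v epr_pairs 1"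
      unfolding epr by (simp add: smult_smult_assoc)
    then show "v \<in> {c \<cdot>\<^sub>v epr_pairs 1 | c. True}" by blast
  qed
  then have "\<sigma> \<in> mixtures (3 * 3) {c \<cdot>\<^sub>v epr_pairs 1 | c. True}"
    using \<sigma> mixtures_mono by blast
  moreover have "epr_pairs 1 \<in> carrier_vec (3 * 3)"
    unfolding epr smult_carrier_vec by (rule bipartite_carrier[OF one_carrier_mat])
  ultimately obtain r where r: "\<sigma> = r \<cdot>\<^sub>m pure_state (epr_pairs 1)"
    using mixtures_of_one_state by blast
  have "mtrace \<sigma> = r * mtrace (pure_state (epr_pairs 1))"
    unfolding r by (simp add: mtrace_def sum_distrib_left pure_state_def)
  \<comment> \<open>The projector has trace 1, so the unknown factor is the trace itself and
    division removes it.\<close>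
  then have "mtrace \<sigma> = r" by (simp only: mtrace_epr_pair mult_1_right)
  with tr show ?thesis unfolding r by (intro eq_matI) auto
qed

lemma purification_protocol_correct: "produces_good_pairs purification_protocol 1 4 1"
  unfolding produces_good_pairs_def
proof (intro allI impI ballI)
  fix T Ks res
  assume T: "T \<subseteq> {..<4} \<and> card T \<le> 1 \<and> quantum_channel (3 ^ card T) Ks"
    and res: "res \<in> set (results (3 ^ 4) (3 ^ 4) purification_protocol (noisy_epr_pairs 4 T Ks))"
  obtain m \<sigma> where m: "res = (m, \<sigma>)" by (cases res)
  have "noisy_epr_pairs 4 T Ks \<in> mixtures (81 * 81) (rays {E. detectable E})"
    using T by (intro noisy_epr_pairs_mixture) (auto simp: quantum_channel_def)
  then have "m = 1 \<and> \<sigma> \<in> mixtures (3 * 3) (rays error_free)"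
    using res m by (intro results_purification_protocol) auto
  then show "case res of (m, \<sigma>) \<Rightarrow> mtrace \<sigma> \<noteq> 0 \<longrightarrow>
      1 \<le> m \<and> 1 / mtrace \<sigma> \<cdot>\<^sub>m \<sigma> = pure_state (epr_pairs m)"
    using normalized_error_free_mixture by (auto simp: m)
qed

theorem mainTheorem5:
  shows "(\<exists>P. two_epp 4 P \<and> produces_good_pairs P 1 4 1) \<and>
    \<not> quantum_singleton_bound 4 1 1 \<and>
    \<not> (\<forall>n k t. (\<exists>P. two_epp n P \<and> produces_good_pairs P k n t) \<longrightarrow> quantum_singleton_bound n k t)"
proof -
  have "\<not> quantum_singleton_bound 4 1 1" by (simp add: quantum_singleton_bound_def)
  then show ?thesis using two_epp_purification_protocol purification_protocol_correct by blast
qed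

end
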